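(* Let $R$ be a ring and let $M$ be a right $R$-module that is quasi-continuous and nonsingular. Then $M$ is almost clean; that is, every endomorphism of $M$ is the sum of an idempotent and a regular element of the ring $\mathrm{End}_R(M)$.
   Context: Rings are associative with identity. An element of a ring is regular if it is neither a left nor a right zero-divisor, i.e. both its left and right annihilators are zero. A ring is almost clean if each of its elements is the sum of a regular element and an idempotent; a module is almost clean if its endomorphism ring is almost clean. A module $M$ is quasi-continuous if it satisfies (C1) every submodule of $M$ is essential in a direct summand of $M$, and (C3) if $A$ and $B$ are direct summands of $M$ with $A\cap B=0$, then $A\oplus B$ is also a direct summand of $M$. A right $R$-module $M$ is nonsingular if no nonzero element of $M$ has an essential right ideal of $R$ as its annihilator. *)

theory Defs
  imports "HOL-Algebra.AbelCoset" "HOL-Library.FuncSet"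
begin

text \<open>
  The locale \<open>module\<close> of HOL-Algebra is restricted to commutative rings. Here the ring is arbitrary
  and acts on the right. As in HOL-Algebra, a module record extends the \<open>ring\<close> record for the sake
  of its additive part; the fields \<open>mult\<close> and \<open>one\<close> of a module are never used.
\<close>

record ('r, 'm) rmodule = "'m ring" +
  ract :: "['m, 'r] \<Rightarrow> 'm" (infixl \<open>\<star>\<index>\<close> 70)

locale right_module = R?: ring R + M?: abelian_group M
  for R (structure) and M :: "('r, 'm, 'z) rmodule_scheme" (structure) +
  assumes ract_closed [simp, intro]:
      "\<lbrakk>x \<in> carrier M; r \<in> carrier R\<rbrakk> \<Longrightarrow> x \<star>\<^bsub>M\<^esub> r \<in> carrier M"
    and ract_add_right:
      "\<lbrakk>x \<in> carrier M; r \<in> carrier R; s \<in> carrier R\<rbrakk>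
        \<Longrightarrow> x \<star>\<^bsub>M\<^esub> (r \<oplus>\<^bsub>R\<^esub> s) = x \<star>\<^bsub>M\<^esub> r \<oplus>\<^bsub>M\<^esub> x \<star>\<^bsub>M\<^esub> s"
    and ract_add_left:
      "\<lbrakk>x \<in> carrier M; y \<in> carrier M; r \<in> carrier R\<rbrakk>
        \<Longrightarrow> (x \<oplus>\<^bsub>M\<^esub> y) \<star>\<^bsub>M\<^esub> r = x \<star>\<^bsub>M\<^esub> r \<oplus>\<^bsub>M\<^esub> y \<star>\<^bsub>M\<^esub> r"
    and ract_assoc:
      "\<lbrakk>x \<in> carrier M; r \<in> carrier R; s \<in> carrier R\<rbrakk>
        \<Longrightarrow> x \<star>\<^bsub>M\<^esub> (r \<otimes>\<^bsub>R\<^esub> s) = (x \<star>\<^bsub>M\<^esub> r) \<star>\<^bsub>M\<^esub> s"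
    and ract_one [simp]:
      "x \<in> carrier M \<Longrightarrow> x \<star>\<^bsub>M\<^esub> \<one>\<^bsub>R\<^esub> = x"

definition rsubmodule :: "('r, 'a) ring_scheme \<Rightarrow> ('r, 'm, 'z) rmodule_scheme \<Rightarrow> 'm set \<Rightarrow> bool"
  where "rsubmodule R M N \<longleftrightarrow>
    subgroup N (add_monoid M) \<and> (\<forall>x\<in>N. \<forall>r\<in>carrier R. x \<star>\<^bsub>M\<^esub> r \<in> N)"

definition essential_in ::
    "('r, 'a) ring_scheme \<Rightarrow> ('r, 'm, 'z) rmodule_scheme \<Rightarrow> 'm set \<Rightarrow> 'm set \<Rightarrow> bool"
  where "essential_in R M N K \<longleftrightarrow>
    rsubmodule R M N \<and> rsubmodule R M K \<and> N \<subseteq> K \<and>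
    (\<forall>L. rsubmodule R M L \<and> L \<subseteq> K \<and> N \<inter> L = {\<zero>\<^bsub>M\<^esub>} \<longrightarrow> L = {\<zero>\<^bsub>M\<^esub>})"

definition direct_summand ::
    "('r, 'a) ring_scheme \<Rightarrow> ('r, 'm, 'z) rmodule_scheme \<Rightarrow> 'm set \<Rightarrow> bool"
  where "direct_summand R M A \<longleftrightarrow>
    rsubmodule R M A \<and>
    (\<exists>B. rsubmodule R M B \<and> A \<inter> B = {\<zero>\<^bsub>M\<^esub>} \<and> A <+>\<^bsub>M\<^esub> B = carrier M)"

definition cond_C1 :: "('r, 'a) ring_scheme \<Rightarrow> ('r, 'm, 'z) rmodule_scheme \<Rightarrow> bool"
  where "cond_C1 R M \<longleftrightarrow>
    (\<forall>N. rsubmodule R M N \<longrightarrow> (\<exists>D. direct_summand R M D \<and> essential_in R M N D))"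

definition cond_C3 :: "('r, 'a) ring_scheme \<Rightarrow> ('r, 'm, 'z) rmodule_scheme \<Rightarrow> bool"
  where "cond_C3 R M \<longleftrightarrow>
    (\<forall>A B. direct_summand R M A \<and> direct_summand R M B \<and> A \<inter> B = {\<zero>\<^bsub>M\<^esub>}
      \<longrightarrow> direct_summand R M (A <+>\<^bsub>M\<^esub> B))"

definition quasi_continuous :: "('r, 'a) ring_scheme \<Rightarrow> ('r, 'm, 'z) rmodule_scheme \<Rightarrow> bool"
  where "quasi_continuous R M \<longleftrightarrow> cond_C1 R M \<and> cond_C3 R M"

text \<open>The ring as a right module over itself; its submodules are the right ideals.\<close>

definition regular_rmodule :: "('r, 'a) ring_scheme \<Rightarrow> ('r, 'r) rmodule"
  where "regular_rmodule R =
    \<lparr>carrier = carrier R, mult = mult R, one = one R, zero = zero R, add = add R, ract = mult R\<rparr>"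

definition essential_right_ideal :: "('r, 'a) ring_scheme \<Rightarrow> 'r set \<Rightarrow> bool"
  where "essential_right_ideal R I \<longleftrightarrow>
    essential_in R (regular_rmodule R) I (carrier R)"

definition annihilator ::
    "('r, 'a) ring_scheme \<Rightarrow> ('r, 'm, 'z) rmodule_scheme \<Rightarrow> 'm \<Rightarrow> 'r set"
  where "annihilator R M x = {r \<in> carrier R. x \<star>\<^bsub>M\<^esub> r = \<zero>\<^bsub>M\<^esub>}"

definition nonsingular :: "('r, 'a) ring_scheme \<Rightarrow> ('r, 'm, 'z) rmodule_scheme \<Rightarrow> bool"
  where "nonsingular R M \<longleftrightarrow>
    (\<forall>x\<in>carrier M. x \<noteq> \<zero>\<^bsub>M\<^esub> \<longrightarrow> \<not> essential_right_ideal R (annihilator R M x))"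

definition left_annihilator :: "('e, 'b) ring_scheme \<Rightarrow> 'e \<Rightarrow> 'e set"
  where "left_annihilator S a = {x \<in> carrier S. x \<otimes>\<^bsub>S\<^esub> a = \<zero>\<^bsub>S\<^esub>}"

definition right_annihilator :: "('e, 'b) ring_scheme \<Rightarrow> 'e \<Rightarrow> 'e set"
  where "right_annihilator S a = {x \<in> carrier S. a \<otimes>\<^bsub>S\<^esub> x = \<zero>\<^bsub>S\<^esub>}"

definition regular_element :: "('e, 'b) ring_scheme \<Rightarrow> 'e \<Rightarrow> bool"
  where "regular_element S a \<longleftrightarrow>
    a \<in> carrier S \<and> left_annihilator S a = {\<zero>\<^bsub>S\<^esub>} \<and> right_annihilator S a = {\<zero>\<^bsub>S\<^esub>}"

definition idempotent_element :: "('e, 'b) ring_scheme \<Rightarrow> 'e \<Rightarrow> bool"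
  where "idempotent_element S e \<longleftrightarrow> e \<in> carrier S \<and> e \<otimes>\<^bsub>S\<^esub> e = e"

definition almost_clean_ring :: "('e, 'b) ring_scheme \<Rightarrow> bool"
  where "almost_clean_ring S \<longleftrightarrow>
    (\<forall>a\<in>carrier S. \<exists>u e. regular_element S u \<and> idempotent_element S e \<and> a = u \<oplus>\<^bsub>S\<^esub> e)"

text \<open>
  Endomorphisms are represented by functions that are \<open>undefined\<close> outside the carrier, so that
  equality in the endomorphism ring is equality of maps on the module.
\<close>

definition rmodule_endos ::
    "('r, 'a) ring_scheme \<Rightarrow> ('r, 'm, 'z) rmodule_scheme \<Rightarrow> ('m \<Rightarrow> 'm) set"
  where "rmodule_endos R M =
    {f \<in> carrier M \<rightarrow>\<^sub>E carrier M.
      (\<forall>x\<in>carrier M. \<forall>y\<in>carrier M. f (x \<oplus>\<^bsub>M\<^esub> y) = f x \<oplus>\<^bsub>M\<^esub> f y) \<and>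
      (\<forall>x\<in>carrier M. \<forall>r\<in>carrier R. f (x \<star>\<^bsub>M\<^esub> r) = f x \<star>\<^bsub>M\<^esub> r)}"

definition End_ring :: "('r, 'a) ring_scheme \<Rightarrow> ('r, 'm, 'z) rmodule_scheme \<Rightarrow> ('m \<Rightarrow> 'm) ring"
  where "End_ring R M =
    \<lparr>carrier = rmodule_endos R M,
     mult = (\<lambda>f g. compose (carrier M) f g),
     one = (\<lambda>x\<in>carrier M. x),
     zero = (\<lambda>x\<in>carrier M. \<zero>\<^bsub>M\<^esub>),
     add = (\<lambda>f g. \<lambda>x\<in>carrier M. f x \<oplus>\<^bsub>M\<^esub> g x)\<rparr>"

definition almost_clean_module :: "('r, 'a) ring_scheme \<Rightarrow> ('r, 'm, 'z) rmodule_scheme \<Rightarrow> bool"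
  where "almost_clean_module R M \<longleftrightarrow> almost_clean_ring (End_ring R M)"

lemma (in ring) right_module_regular: "right_module R (regular_rmodule R)"
proof -
  have "abelian_group (regular_rmodule R)"
    by (rule abelian_groupI)
      (auto simp: regular_rmodule_def a_ac intro: add.l_inv_ex)
  then show ?thesis
    by (intro right_module.intro right_module_axioms.intro ring_axioms)
      (auto simp: regular_rmodule_def l_distr r_distr m_assoc)
qed

context right_module
begin

lemma ract_zero_left [simp]:
  assumes "r \<in> carrier R" shows "\<zero>\<^bsub>M\<^esub> \<star>\<^bsub>M\<^esub> r = \<zero>\<^bsub>M\<^esub>"
proof -
  have "\<zero>\<^bsub>M\<^esub> \<star>\<^bsub>M\<^esub> r \<oplus>\<^bsub>M\<^esub> \<zero>\<^bsub>M\<^esub> \<star>\<^bsub>M\<^esub> r = \<zero>\<^bsub>M\<^esub> \<star>\<^bsub>M\<^esub> r"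
    using ract_add_left[of "\<zero>\<^bsub>M\<^esub>" "\<zero>\<^bsub>M\<^esub>" r] assms by simp
  then show ?thesis using assms by (metis M.add.r_cancel_one' M.zero_closed ract_closed)
qed

lemma ract_minus_left:
  assumes "x \<in> carrier M" "r \<in> carrier R"
  shows "(\<ominus>\<^bsub>M\<^esub> x) \<star>\<^bsub>M\<^esub> r = \<ominus>\<^bsub>M\<^esub> (x \<star>\<^bsub>M\<^esub> r)"
proof -
  have "(\<ominus>\<^bsub>M\<^esub> x) \<star>\<^bsub>M\<^esub> r \<oplus>\<^bsub>M\<^esub> x \<star>\<^bsub>M\<^esub> r = \<zero>\<^bsub>M\<^esub>"
    using ract_add_left[of "\<ominus>\<^bsub>M\<^esub> x" x r] assms by (simp add: M.l_neg)
  then show ?thesis using assms by (simp add: M.minus_equality)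
qed

lemma rmodule_endos_closed:
  "\<lbrakk>f \<in> rmodule_endos R M; x \<in> carrier M\<rbrakk> \<Longrightarrow> f x \<in> carrier M"
  by (auto simp: rmodule_endos_def)

lemma End_ring_is_ring: "ring (End_ring R M)"
proof -
  note endo = rmodule_endos_closed
  have mem: "f \<in> rmodule_endos R M \<longleftrightarrow> f \<in> extensional (carrier M) \<and>
      (\<forall>x\<in>carrier M. f x \<in> carrier M) \<and>
      (\<forall>x\<in>carrier M. \<forall>y\<in>carrier M. f (x \<oplus>\<^bsub>M\<^esub> y) = f x \<oplus>\<^bsub>M\<^esub> f y) \<and>
      (\<forall>x\<in>carrier M. \<forall>r\<in>carrier R. f (x \<star>\<^bsub>M\<^esub> r) = f x \<star>\<^bsub>M\<^esub> r)" for f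
    by (auto simp: rmodule_endos_def PiE_def)
  have add: "(\<lambda>x\<in>carrier M. f x \<oplus>\<^bsub>M\<^esub> g x) \<in> rmodule_endos R M"
    if "f \<in> rmodule_endos R M" "g \<in> rmodule_endos R M" for f g
    using that by (auto simp: mem M.a_ac ract_add_left)
  have mul: "compose (carrier M) f g \<in> rmodule_endos R M"
    if "f \<in> rmodule_endos R M" "g \<in> rmodule_endos R M" for f g
    using that by (auto simp: mem compose_def)
  have restr: "restrict f (carrier M) = f" if "f \<in> rmodule_endos R M" for f
    using that by (simp add: mem extensional_restrict)
  have zero: "(\<lambda>x\<in>carrier M. \<zero>\<^bsub>M\<^esub>) \<in> rmodule_endos R M"
    by (auto simp: mem)
  have one: "(\<lambda>x\<in>carrier M. x) \<in> rmodule_endos R M"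
    by (auto simp: mem)
  have neg: "(\<lambda>x\<in>carrier M. \<ominus>\<^bsub>M\<^esub> f x) \<in> rmodule_endos R M"
    if "f \<in> rmodule_endos R M" for f
    using that by (auto simp: mem M.minus_add ract_minus_left)
  have "abelian_group (End_ring R M)"
  proof (rule abelian_groupI)
    fix f assume f: "f \<in> carrier (End_ring R M)"
    then have "(\<lambda>x\<in>carrier M. \<ominus>\<^bsub>M\<^esub> f x) \<oplus>\<^bsub>End_ring R M\<^esub> f = \<zero>\<^bsub>End_ring R M\<^esub>"
      by (auto simp: End_ring_def endo M.l_neg intro!: restrict_ext)
    moreover have "(\<lambda>x\<in>carrier M. \<ominus>\<^bsub>M\<^esub> f x) \<in> carrier (End_ring R M)"
      using neg f by (simp add: End_ring_def)
    ultimately show "\<exists>g\<in>carrier (End_ring R M). g \<oplus>\<^bsub>End_ring R M\<^esub> f = \<zero>\<^bsub>End_ring R M\<^esub>"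
      by blast
  qed (auto simp: End_ring_def add zero endo restr M.a_ac
      cong: restrict_cong intro!: restrict_ext)
  moreover have "Group.monoid (End_ring R M)"
    by (rule monoidI)
      (auto simp: End_ring_def mul[unfolded compose_def] one endo compose_def restr cong: restrict_cong intro!: restrict_ext)
  moreover have "compose (carrier M) h (\<lambda>x\<in>carrier M. f x \<oplus>\<^bsub>M\<^esub> g x) =
      (\<lambda>x\<in>carrier M. h (f x) \<oplus>\<^bsub>M\<^esub> h (g x))"
    if "f \<in> rmodule_endos R M" "g \<in> rmodule_endos R M" "h \<in> rmodule_endos R M" for f g h
    using that by (auto simp: compose_def mem intro!: restrict_ext)
  ultimately show ?thesis
    by (intro ringI)
      (auto simp: End_ring_def endo compose_def cong: restrict_cong)
qed

end

end

theory Submission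
  imports Defs
begin

text \<open>
  Let \<open>f\<close> be an endomorphism of \<open>M\<close> and \<open>g = 1 - f\<close>. Suppose \<open>M = A \<oplus> B\<close> where \<open>f\<close> is injective
  on \<open>A\<close>, \<open>g\<close> is injective on \<open>B\<close>, and \<open>f A \<inter> g B = 0\<close> with \<open>f A + g B\<close> essential. If \<open>e\<close> is the
  projection to \<open>B\<close> along \<open>A\<close>, then \<open>u = f - e\<close> maps \<open>a + b\<close> to \<open>f a - g b\<close>; so \<open>u\<close> is injective
  with essential image, and in a nonsingular module such an endomorphism is regular
  (\<open>decomposition_of_spanning_clean_pair\<close>). The task is to find \<open>A\<close> and \<open>B\<close>.

  In a nonsingular module every submodule \<open>N\<close> has a largest essential extension inside \<open>M\<close>,
  \<open>closure N\<close>. A clean pair is a pair \<open>(A, B)\<close> with the properties above, except that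
  \<open>A + B\<close> need not be \<open>M\<close>; instead \<open>A + B\<close> and \<open>f A + g B\<close> have the same closure \<open>W\<close>. Then \<open>W\<close>
  is invariant under \<open>f\<close>. Zorn's lemma provides a maximal clean pair. If \<open>W\<close> were not
  \<open>M\<close>, the pair could be enlarged by considering \<open>f\<close> modulo \<open>W\<close>:

  \<^item> If \<open>f\<close> has a kernel modulo \<open>W\<close>, part of it is added to \<open>B\<close> (\<open>clean_pair_extend_kernel\<close>).
  \<^item> If \<open>f\<close> is injective modulo \<open>W\<close> and some \<open>L \<noteq> 0\<close> satisfies \<open>L \<inter> (f M + W) = 0\<close>, then
    \<open>L, f L, f\<^sup>2 L, \<dots>\<close> are independent modulo \<open>W\<close>, and \<open>f\<close> acts on their sum as a shift. Shifts
    are clean by an explicit formula (\<open>clean_pair_extend_shift\<close>).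
  \<^item> If \<open>f\<close> is injective modulo \<open>W\<close> and \<open>f M + W\<close> is essential, a complement of \<open>W\<close> is
    added to \<open>A\<close> (\<open>clean_pair_extend_complement\<close>).

  So \<open>A + B\<close> is essential in \<open>M\<close>. Finally (C1) replaces \<open>A\<close> and \<open>B\<close> by summands in which they
  are essential, and (C3) makes their sum a summand, hence all of \<open>M\<close>.
\<close>

section \<open>Submodules and their sums\<close>

context right_module
begin

lemma ract_zero_right [simp]:
  assumes "x \<in> carrier M" shows "x \<star>\<^bsub>M\<^esub> \<zero>\<^bsub>R\<^esub> = \<zero>\<^bsub>M\<^esub>"
proof -
  have "x \<star>\<^bsub>M\<^esub> \<zero>\<^bsub>R\<^esub> \<oplus>\<^bsub>M\<^esub> x \<star>\<^bsub>M\<^esub> \<zero>\<^bsub>R\<^esub> = x \<star>\<^bsub>M\<^esub> \<zero>\<^bsub>R\<^esub>"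
    using ract_add_right[of x "\<zero>\<^bsub>R\<^esub>" "\<zero>\<^bsub>R\<^esub>"] assms by simp
  then show ?thesis
    using assms by (metis M.add.r_cancel_one' R.zero_closed ract_closed)
qed

lemma rsubmoduleI:
  assumes "N \<subseteq> carrier M" "\<zero>\<^bsub>M\<^esub> \<in> N"
    and "\<And>x y. \<lbrakk>x \<in> N; y \<in> N\<rbrakk> \<Longrightarrow> x \<oplus>\<^bsub>M\<^esub> y \<in> N"
    and act: "\<And>x r. \<lbrakk>x \<in> N; r \<in> carrier R\<rbrakk> \<Longrightarrow> x \<star>\<^bsub>M\<^esub> r \<in> N"
  shows "rsubmodule R M N"
proof -
  have "\<ominus>\<^bsub>M\<^esub> x \<in> N" if "x \<in> N" for x
  proof -
    have x: "x \<in> carrier M" using that assms(1) by auto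
    have "x \<star>\<^bsub>M\<^esub> (\<ominus>\<^bsub>R\<^esub> \<one>\<^bsub>R\<^esub>) \<oplus>\<^bsub>M\<^esub> x = x \<star>\<^bsub>M\<^esub> (\<ominus>\<^bsub>R\<^esub> \<one>\<^bsub>R\<^esub> \<oplus>\<^bsub>R\<^esub> \<one>\<^bsub>R\<^esub>)"
      using x by (simp add: ract_add_right)
    also have "\<dots> = \<zero>\<^bsub>M\<^esub>" using x by (simp add: R.l_neg)
    finally have "\<ominus>\<^bsub>M\<^esub> x = x \<star>\<^bsub>M\<^esub> (\<ominus>\<^bsub>R\<^esub> \<one>\<^bsub>R\<^esub>)"
      using x by (simp add: M.minus_equality)
    then show ?thesis using act that by simp
  qed
  then show ?thesis
    using assms by (auto simp: rsubmodule_def a_inv_def intro!: subgroup.intro)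
qed

lemma rsubmodule_subset: "rsubmodule R M N \<Longrightarrow> N \<subseteq> carrier M"
  and rsubmodule_zero: "rsubmodule R M N \<Longrightarrow> \<zero>\<^bsub>M\<^esub> \<in> N"
  and rsubmodule_add: "\<lbrakk>rsubmodule R M N; x \<in> N; y \<in> N\<rbrakk> \<Longrightarrow> x \<oplus>\<^bsub>M\<^esub> y \<in> N"
  and rsubmodule_minus: "\<lbrakk>rsubmodule R M N; x \<in> N\<rbrakk> \<Longrightarrow> \<ominus>\<^bsub>M\<^esub> x \<in> N"
  and rsubmodule_ract: "\<lbrakk>rsubmodule R M N; x \<in> N; r \<in> carrier R\<rbrakk> \<Longrightarrow> x \<star>\<^bsub>M\<^esub> r \<in> N"
  using subgroup.subset[of N "add_monoid M"] subgroup.one_closed[of N "add_monoid M"]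
    subgroup.m_closed[of N "add_monoid M"] subgroup.m_inv_closed[of N "add_monoid M"]
  by (auto simp: rsubmodule_def a_inv_def)

lemma rsubmodule_carrier: "rsubmodule R M N \<Longrightarrow> x \<in> N \<Longrightarrow> x \<in> carrier M"
  using rsubmodule_subset by auto

lemma rsubmodule_add_cancel:
  assumes N: "rsubmodule R M N" and "x \<in> N" "x \<oplus>\<^bsub>M\<^esub> y \<in> N" "y \<in> carrier M"
  shows "y \<in> N"
proof -
  have "y = \<ominus>\<^bsub>M\<^esub> x \<oplus>\<^bsub>M\<^esub> (x \<oplus>\<^bsub>M\<^esub> y)"
    using assms rsubmodule_carrier[OF N] by (simp add: M.r_neg1)
  then show ?thesis using assms rsubmodule_add rsubmodule_minus by metis
qed

lemma rsubmodule_all: "rsubmodule R M (carrier M)"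
  by (rule rsubmoduleI) auto

lemma rsubmodule_trivial: "rsubmodule R M {\<zero>\<^bsub>M\<^esub>}"
  by (rule rsubmoduleI) auto

lemma rsubmodule_sum:
  assumes N: "rsubmodule R M N" and K: "rsubmodule R M K"
  shows "rsubmodule R M (N <+>\<^bsub>M\<^esub> K)"
proof (rule rsubmoduleI)
  note c = rsubmodule_carrier[OF N] rsubmodule_carrier[OF K]
  show "N <+>\<^bsub>M\<^esub> K \<subseteq> carrier M"
    using c by (auto simp: set_add_def')
  show "\<zero>\<^bsub>M\<^esub> \<in> N <+>\<^bsub>M\<^esub> K"
    using rsubmodule_zero[OF N] rsubmodule_zero[OF K] by (force simp: set_add_def')
  fix x y assume "x \<in> N <+>\<^bsub>M\<^esub> K" "y \<in> N <+>\<^bsub>M\<^esub> K"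
  then obtain n k n' k' where *: "n \<in> N" "k \<in> K" "n' \<in> N" "k' \<in> K"
    "x = n \<oplus>\<^bsub>M\<^esub> k" "y = n' \<oplus>\<^bsub>M\<^esub> k'" by (auto simp: set_add_def')
  then have "x \<oplus>\<^bsub>M\<^esub> y = (n \<oplus>\<^bsub>M\<^esub> n') \<oplus>\<^bsub>M\<^esub> (k \<oplus>\<^bsub>M\<^esub> k')"
    using c by (simp add: M.a_ac)
  moreover have "n \<oplus>\<^bsub>M\<^esub> n' \<in> N" "k \<oplus>\<^bsub>M\<^esub> k' \<in> K"
    using * rsubmodule_add[OF N] rsubmodule_add[OF K] by auto
  ultimately show "x \<oplus>\<^bsub>M\<^esub> y \<in> N <+>\<^bsub>M\<^esub> K"
    unfolding set_add_def' by blast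
next
  note c = rsubmodule_carrier[OF N] rsubmodule_carrier[OF K]
  fix x r assume "x \<in> N <+>\<^bsub>M\<^esub> K" and r: "r \<in> carrier R"
  then obtain n k where *: "n \<in> N" "k \<in> K" "x = n \<oplus>\<^bsub>M\<^esub> k" by (auto simp: set_add_def')
  then have "x \<star>\<^bsub>M\<^esub> r = n \<star>\<^bsub>M\<^esub> r \<oplus>\<^bsub>M\<^esub> k \<star>\<^bsub>M\<^esub> r"
    using c r by (simp add: ract_add_left)
  moreover have "n \<star>\<^bsub>M\<^esub> r \<in> N" "k \<star>\<^bsub>M\<^esub> r \<in> K"
    using * r rsubmodule_ract[OF N] rsubmodule_ract[OF K] by auto
  ultimately show "x \<star>\<^bsub>M\<^esub> r \<in> N <+>\<^bsub>M\<^esub> K"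
    unfolding set_add_def' by blast
qed

lemma sum_subset_left:
  assumes N: "rsubmodule R M N" and K: "rsubmodule R M K" shows "N \<subseteq> N <+>\<^bsub>M\<^esub> K"
proof
  fix x assume x: "x \<in> N"
  then have "x = x \<oplus>\<^bsub>M\<^esub> \<zero>\<^bsub>M\<^esub>" using rsubmodule_carrier[OF N] by simp
  then show "x \<in> N <+>\<^bsub>M\<^esub> K"
    using x rsubmodule_zero[OF K] by (auto simp: set_add_def')
qed

lemma sum_subset_right:
  assumes N: "rsubmodule R M N" and K: "rsubmodule R M K" shows "K \<subseteq> N <+>\<^bsub>M\<^esub> K"
proof
  fix x assume x: "x \<in> K"
  then have "x = \<zero>\<^bsub>M\<^esub> \<oplus>\<^bsub>M\<^esub> x" using rsubmodule_carrier[OF K] by simp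
  then show "x \<in> N <+>\<^bsub>M\<^esub> K"
    using x rsubmodule_zero[OF N] by (auto simp: set_add_def')
qed

lemma sum_least:
  assumes "rsubmodule R M L" "N \<subseteq> L" "K \<subseteq> L" shows "N <+>\<^bsub>M\<^esub> K \<subseteq> L"
  using assms by (auto simp: set_add_def' intro: rsubmodule_add)

lemma set_add_mono: "\<lbrakk>N \<subseteq> N'; K \<subseteq> K'\<rbrakk> \<Longrightarrow> N <+>\<^bsub>M\<^esub> K \<subseteq> N' <+>\<^bsub>M\<^esub> K'"
  by (auto simp: set_add_def')

lemma rsubmodule_cyclic:
  assumes x: "x \<in> carrier M"
  shows "rsubmodule R M ((\<lambda>r. x \<star>\<^bsub>M\<^esub> r) ` carrier R)"
proof (rule rsubmoduleI)
  show "\<zero>\<^bsub>M\<^esub> \<in> (\<lambda>r. x \<star>\<^bsub>M\<^esub> r) ` carrier R"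
    using x by (force intro: image_eqI[where x = "\<zero>\<^bsub>R\<^esub>"])
qed (use x in \<open>auto simp: ract_add_right[symmetric] ract_assoc[symmetric]\<close>)

lemma rsubmodule_Union_chain:
  assumes ne: "\<N> \<noteq> {}" and sub: "\<And>N. N \<in> \<N> \<Longrightarrow> rsubmodule R M N"
    and ch: "\<And>N K. \<lbrakk>N \<in> \<N>; K \<in> \<N>\<rbrakk> \<Longrightarrow> N \<subseteq> K \<or> K \<subseteq> N"
  shows "rsubmodule R M (\<Union>\<N>)"
proof (rule rsubmoduleI)
  show "\<Union>\<N> \<subseteq> carrier M" using sub rsubmodule_subset by blast
  show "\<zero>\<^bsub>M\<^esub> \<in> \<Union>\<N>" using ne sub rsubmodule_zero by blast
  fix x y assume "x \<in> \<Union>\<N>" "y \<in> \<Union>\<N>"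
  then obtain N K where "x \<in> N" "N \<in> \<N>" "y \<in> K" "K \<in> \<N>" by auto
  with ch[of N K] show "x \<oplus>\<^bsub>M\<^esub> y \<in> \<Union>\<N>"
    using sub rsubmodule_add by (meson UnionI subsetD)
qed (use sub rsubmodule_ract in blast)


section \<open>The closure of a submodule\<close>

text \<open>
  The Goldie closure of \<open>N\<close>: the elements \<open>x\<close> for which the right ideal of all \<open>r\<close> with
  \<open>x r \<in> N\<close> is essential in \<open>R\<close>. Essentiality of that right ideal is spelled out
  elementwise, since this is the form in which two essential conditions are combined below.
\<close>

definition closure :: "'m set \<Rightarrow> 'm set"
  where "closure N = {x \<in> carrier M. \<forall>r\<in>carrier R. r \<noteq> \<zero>\<^bsub>R\<^esub> \<longrightarrow>
    (\<exists>s\<in>carrier R. r \<otimes>\<^bsub>R\<^esub> s \<noteq> \<zero>\<^bsub>R\<^esub> \<and> x \<star>\<^bsub>M\<^esub> (r \<otimes>\<^bsub>R\<^esub> s) \<in> N)}"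

lemma closureI:
  assumes "x \<in> carrier M"
    and "\<And>r. \<lbrakk>r \<in> carrier R; r \<noteq> \<zero>\<^bsub>R\<^esub>\<rbrakk> \<Longrightarrow>
      \<exists>s\<in>carrier R. r \<otimes>\<^bsub>R\<^esub> s \<noteq> \<zero>\<^bsub>R\<^esub> \<and> x \<star>\<^bsub>M\<^esub> (r \<otimes>\<^bsub>R\<^esub> s) \<in> N"
  shows "x \<in> closure N"
  using assms by (auto simp: closure_def)

lemma closureE:
  assumes "x \<in> closure N" "r \<in> carrier R" "r \<noteq> \<zero>\<^bsub>R\<^esub>"
  obtains s where "s \<in> carrier R" "r \<otimes>\<^bsub>R\<^esub> s \<noteq> \<zero>\<^bsub>R\<^esub>" "x \<star>\<^bsub>M\<^esub> (r \<otimes>\<^bsub>R\<^esub> s) \<in> N"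
  using assms by (auto simp: closure_def)

lemma closure_carrier: "x \<in> closure N \<Longrightarrow> x \<in> carrier M"
  by (auto simp: closure_def)

lemma closure_mono: "N \<subseteq> K \<Longrightarrow> closure N \<subseteq> closure K"
  by (fastforce simp: closure_def)

lemma subset_closure:
  assumes N: "rsubmodule R M N" shows "N \<subseteq> closure N"
proof
  fix x assume x: "x \<in> N"
  show "x \<in> closure N"
  proof (rule closureI)
    show "x \<in> carrier M" using x N rsubmodule_carrier by blast
    fix r assume "r \<in> carrier R" "r \<noteq> \<zero>\<^bsub>R\<^esub>"
    then show "\<exists>s\<in>carrier R. r \<otimes>\<^bsub>R\<^esub> s \<noteq> \<zero>\<^bsub>R\<^esub> \<and> x \<star>\<^bsub>M\<^esub> (r \<otimes>\<^bsub>R\<^esub> s) \<in> N"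
      using x N by (intro bexI[of _ "\<one>\<^bsub>R\<^esub>"]) (auto intro: rsubmodule_ract)
  qed
qed

lemma rsubmodule_closure:
  assumes N: "rsubmodule R M N" shows "rsubmodule R M (closure N)"
proof (rule rsubmoduleI)
  show "closure N \<subseteq> carrier M" by (auto simp: closure_def)
  show "\<zero>\<^bsub>M\<^esub> \<in> closure N" using N subset_closure rsubmodule_zero by blast
next
  fix x y assume x: "x \<in> closure N" and y: "y \<in> closure N"
  note c = closure_carrier[OF x] closure_carrier[OF y]
  show "x \<oplus>\<^bsub>M\<^esub> y \<in> closure N"
  proof (rule closureI)
    show "x \<oplus>\<^bsub>M\<^esub> y \<in> carrier M" using c by simp
    fix r assume r: "r \<in> carrier R" "r \<noteq> \<zero>\<^bsub>R\<^esub>"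
    from closureE[OF x r] obtain s where s: "s \<in> carrier R" "r \<otimes>\<^bsub>R\<^esub> s \<noteq> \<zero>\<^bsub>R\<^esub>"
      "x \<star>\<^bsub>M\<^esub> (r \<otimes>\<^bsub>R\<^esub> s) \<in> N" .
    have rs: "r \<otimes>\<^bsub>R\<^esub> s \<in> carrier R" using r s by simp
    from closureE[OF y rs s(2)] obtain t where t: "t \<in> carrier R" "r \<otimes>\<^bsub>R\<^esub> s \<otimes>\<^bsub>R\<^esub> t \<noteq> \<zero>\<^bsub>R\<^esub>"
      "y \<star>\<^bsub>M\<^esub> (r \<otimes>\<^bsub>R\<^esub> s \<otimes>\<^bsub>R\<^esub> t) \<in> N" .
    have "(x \<oplus>\<^bsub>M\<^esub> y) \<star>\<^bsub>M\<^esub> (r \<otimes>\<^bsub>R\<^esub> s \<otimes>\<^bsub>R\<^esub> t) \<in> N"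
      using c rs t s N
      by (simp add: ract_add_left ract_assoc[of x "r \<otimes>\<^bsub>R\<^esub> s"] rsubmodule_add rsubmodule_ract)
    then show "\<exists>s\<in>carrier R. r \<otimes>\<^bsub>R\<^esub> s \<noteq> \<zero>\<^bsub>R\<^esub> \<and> (x \<oplus>\<^bsub>M\<^esub> y) \<star>\<^bsub>M\<^esub> (r \<otimes>\<^bsub>R\<^esub> s) \<in> N"
      using r s t by (intro bexI[of _ "s \<otimes>\<^bsub>R\<^esub> t"]) (auto simp: R.m_assoc)
  qed
next
  fix x t assume x: "x \<in> closure N" and t: "t \<in> carrier R"
  note c = closure_carrier[OF x]
  show "x \<star>\<^bsub>M\<^esub> t \<in> closure N"
  proof (rule closureI)
    show "x \<star>\<^bsub>M\<^esub> t \<in> carrier M" using c t by simp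
    fix r assume r: "r \<in> carrier R" "r \<noteq> \<zero>\<^bsub>R\<^esub>"
    show "\<exists>s\<in>carrier R. r \<otimes>\<^bsub>R\<^esub> s \<noteq> \<zero>\<^bsub>R\<^esub> \<and> x \<star>\<^bsub>M\<^esub> t \<star>\<^bsub>M\<^esub> (r \<otimes>\<^bsub>R\<^esub> s) \<in> N"
    proof (cases "t \<otimes>\<^bsub>R\<^esub> r = \<zero>\<^bsub>R\<^esub>")
      case True
      then have "x \<star>\<^bsub>M\<^esub> t \<star>\<^bsub>M\<^esub> (r \<otimes>\<^bsub>R\<^esub> \<one>\<^bsub>R\<^esub>) = \<zero>\<^bsub>M\<^esub>"
        using c t r by (simp add: ract_assoc[symmetric])
      then show ?thesis using r N rsubmodule_zero by (intro bexI[of _ "\<one>\<^bsub>R\<^esub>"]) auto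
    next
      case False
      have tr: "t \<otimes>\<^bsub>R\<^esub> r \<in> carrier R" using t r by simp
      from closureE[OF x tr False] obtain s where s: "s \<in> carrier R" "t \<otimes>\<^bsub>R\<^esub> r \<otimes>\<^bsub>R\<^esub> s \<noteq> \<zero>\<^bsub>R\<^esub>"
        "x \<star>\<^bsub>M\<^esub> (t \<otimes>\<^bsub>R\<^esub> r \<otimes>\<^bsub>R\<^esub> s) \<in> N" .
      then have "r \<otimes>\<^bsub>R\<^esub> s \<noteq> \<zero>\<^bsub>R\<^esub>" using t r by (auto simp: R.m_assoc)
      then show ?thesis
        using s c t r by (intro bexI[of _ s]) (auto simp: ract_assoc[symmetric] R.m_assoc)
    qed
  qed
qed

text \<open>
  Essential extensions lie in the closure, because \<open>x r R\<close> meets \<open>N\<close> nontrivially as soon as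
  \<open>x r \<noteq> 0\<close>.
\<close>

lemma essential_in_closure:
  assumes "essential_in R M N K" shows "K \<subseteq> closure N"
proof
  fix x assume "x \<in> K"
  have N: "rsubmodule R M N" and K: "rsubmodule R M K"
    and ess: "\<And>L. rsubmodule R M L \<Longrightarrow> L \<subseteq> K \<Longrightarrow> N \<inter> L = {\<zero>\<^bsub>M\<^esub>} \<Longrightarrow> L = {\<zero>\<^bsub>M\<^esub>}"
    using assms by (auto simp: essential_in_def)
  have x: "x \<in> carrier M" using K \<open>x \<in> K\<close> rsubmodule_carrier by blast
  show "x \<in> closure N"
  proof (rule closureI[OF x])
    fix r assume r: "r \<in> carrier R" "r \<noteq> \<zero>\<^bsub>R\<^esub>"
    let ?L = "(\<lambda>s. (x \<star>\<^bsub>M\<^esub> r) \<star>\<^bsub>M\<^esub> s) ` carrier R"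
    show "\<exists>s\<in>carrier R. r \<otimes>\<^bsub>R\<^esub> s \<noteq> \<zero>\<^bsub>R\<^esub> \<and> x \<star>\<^bsub>M\<^esub> (r \<otimes>\<^bsub>R\<^esub> s) \<in> N"
    proof (cases "x \<star>\<^bsub>M\<^esub> r = \<zero>\<^bsub>M\<^esub>")
      case True
      then show ?thesis using r N rsubmodule_zero by (intro bexI[of _ "\<one>\<^bsub>R\<^esub>"]) auto
    next
      case False
      have L: "rsubmodule R M ?L" using x r by (simp add: rsubmodule_cyclic)
      have "x \<star>\<^bsub>M\<^esub> r \<star>\<^bsub>M\<^esub> \<one>\<^bsub>R\<^esub> \<in> ?L" by (rule imageI) simp
      then have "?L \<noteq> {\<zero>\<^bsub>M\<^esub>}" using False x r by auto
      moreover have "?L \<subseteq> K" using K \<open>x \<in> K\<close> r by (auto intro!: rsubmodule_ract)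
      ultimately have "N \<inter> ?L \<noteq> {\<zero>\<^bsub>M\<^esub>}" using ess[OF L] by blast
      then obtain s where s: "s \<in> carrier R" "x \<star>\<^bsub>M\<^esub> r \<star>\<^bsub>M\<^esub> s \<in> N" "x \<star>\<^bsub>M\<^esub> r \<star>\<^bsub>M\<^esub> s \<noteq> \<zero>\<^bsub>M\<^esub>"
        using rsubmodule_zero[OF N] rsubmodule_zero[OF L] by blast
      then show ?thesis
        using x r by (intro bexI[of _ s]) (auto simp: ract_assoc[symmetric])
    qed
  qed
qed

text \<open>
  This is how nonzero submodules disjoint from a closed submodule are produced: an element
  outside the closure has a multiple whose cyclic submodule avoids \<open>N\<close>.
\<close>

lemma not_in_closure:
  assumes N: "rsubmodule R M N" and x: "x \<in> carrier M" "x \<notin> closure N"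
  obtains r where "r \<in> carrier R" "x \<star>\<^bsub>M\<^esub> r \<noteq> \<zero>\<^bsub>M\<^esub>"
    "(\<lambda>s. (x \<star>\<^bsub>M\<^esub> r) \<star>\<^bsub>M\<^esub> s) ` carrier R \<inter> N = {\<zero>\<^bsub>M\<^esub>}"
proof -
  obtain r where r: "r \<in> carrier R" "r \<noteq> \<zero>\<^bsub>R\<^esub>"
    and *: "\<And>s. \<lbrakk>s \<in> carrier R; x \<star>\<^bsub>M\<^esub> (r \<otimes>\<^bsub>R\<^esub> s) \<in> N\<rbrakk> \<Longrightarrow> r \<otimes>\<^bsub>R\<^esub> s = \<zero>\<^bsub>R\<^esub>"
    using x closureI[of x N] by blast
  show thesis
  proof
    show "x \<star>\<^bsub>M\<^esub> r \<noteq> \<zero>\<^bsub>M\<^esub>"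
      using *[of "\<one>\<^bsub>R\<^esub>"] r rsubmodule_zero[OF N] by auto
    have "\<zero>\<^bsub>M\<^esub> \<in> (\<lambda>s. (x \<star>\<^bsub>M\<^esub> r) \<star>\<^bsub>M\<^esub> s) ` carrier R"
      using rsubmodule_zero[OF rsubmodule_cyclic] x r by simp
    moreover have "x \<star>\<^bsub>M\<^esub> r \<star>\<^bsub>M\<^esub> s = \<zero>\<^bsub>M\<^esub>" if "s \<in> carrier R" "x \<star>\<^bsub>M\<^esub> r \<star>\<^bsub>M\<^esub> s \<in> N" for s
      using that *[of s] x r by (simp add: ract_assoc[symmetric])
    ultimately show "(\<lambda>s. (x \<star>\<^bsub>M\<^esub> r) \<star>\<^bsub>M\<^esub> s) ` carrier R \<inter> N = {\<zero>\<^bsub>M\<^esub>}"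
      using rsubmodule_zero[OF N] by blast
  qed (fact r)
qed

end


locale nonsingular_right_module = right_module R M
  for R :: "('r, 'a) ring_scheme" (structure) and M :: "('r, 'm, 'z) rmodule_scheme" (structure) +
  assumes nonsing: "nonsingular R M"
begin

lemma closure_trivial: "closure {\<zero>\<^bsub>M\<^esub>} = {\<zero>\<^bsub>M\<^esub>}"
proof
  show "{\<zero>\<^bsub>M\<^esub>} \<subseteq> closure {\<zero>\<^bsub>M\<^esub>}" by (rule subset_closure[OF rsubmodule_trivial])
  show "closure {\<zero>\<^bsub>M\<^esub>} \<subseteq> {\<zero>\<^bsub>M\<^esub>}"
  proof
    fix x assume x: "x \<in> closure {\<zero>\<^bsub>M\<^esub>}"
    note c = closure_carrier[OF x]
    interpret reg: right_module R "regular_rmodule R" by (rule R.right_module_regular)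
    have simps: "carrier (regular_rmodule R) = carrier R" "add (regular_rmodule R) = add R"
      "zero (regular_rmodule R) = zero R" "ract (regular_rmodule R) = mult R"
      by (auto simp: regular_rmodule_def)
    have I: "rsubmodule R (regular_rmodule R) (annihilator R M x)"
      by (rule reg.rsubmoduleI)
        (use c in \<open>auto simp: simps annihilator_def ract_add_right ract_assoc\<close>)
    have "essential_right_ideal R (annihilator R M x)"
      unfolding essential_right_ideal_def essential_in_def simps
    proof (intro conjI allI impI)
      show "rsubmodule R (regular_rmodule R) (annihilator R M x)" by (rule I)
      show "rsubmodule R (regular_rmodule R) (carrier R)"
        using reg.rsubmodule_all by (simp add: simps)
      show "annihilator R M x \<subseteq> carrier R" by (auto simp: annihilator_def)
      fix L
      assume *: "rsubmodule R (regular_rmodule R) L \<and> L \<subseteq> carrier R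
        \<and> annihilator R M x \<inter> L = {\<zero>\<^bsub>R\<^esub>}"
      show "L = {\<zero>\<^bsub>R\<^esub>}"
      proof (rule ccontr)
        assume "L \<noteq> {\<zero>\<^bsub>R\<^esub>}"
        then obtain r where r: "r \<in> L" "r \<in> carrier R" "r \<noteq> \<zero>\<^bsub>R\<^esub>" using * by blast
        from closureE[OF x r(2,3)] obtain s where s: "s \<in> carrier R" "r \<otimes>\<^bsub>R\<^esub> s \<noteq> \<zero>\<^bsub>R\<^esub>"
          "x \<star>\<^bsub>M\<^esub> (r \<otimes>\<^bsub>R\<^esub> s) = \<zero>\<^bsub>M\<^esub>" by auto
        then have "r \<otimes>\<^bsub>R\<^esub> s \<in> annihilator R M x \<inter> L"
          using r * reg.rsubmodule_ract[of L r s] by (auto simp: simps annihilator_def)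
        then show False using * s by auto
      qed
    qed
    then show "x \<in> {\<zero>\<^bsub>M\<^esub>}" using nonsing c by (auto simp: nonsingular_def)
  qed
qed

text \<open>
  Let \<open>x p \<in> closure N\<close>. Either some \<open>t\<close> has \<open>p t \<noteq> 0\<close> and \<open>x p t \<in> N\<close>, as wanted. Or \<open>p t = 0\<close>
  whenever \<open>x p t \<in> N\<close>; then the essential right ideal of all such \<open>t\<close> kills \<open>x p\<close>, so
  nonsingularity gives \<open>x p = 0 \<in> N\<close>.
\<close>

lemma closure_idem:
  assumes N: "rsubmodule R M N" shows "closure (closure N) = closure N"
proof
  show "closure N \<subseteq> closure (closure N)"
    by (rule subset_closure[OF rsubmodule_closure[OF N]])
  show "closure (closure N) \<subseteq> closure N"
  proof
    fix x assume x: "x \<in> closure (closure N)"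
    note c = closure_carrier[OF x]
    show "x \<in> closure N"
    proof (rule closureI[OF c])
      fix r assume r: "r \<in> carrier R" "r \<noteq> \<zero>\<^bsub>R\<^esub>"
      from closureE[OF x r] obtain s where s: "s \<in> carrier R" "r \<otimes>\<^bsub>R\<^esub> s \<noteq> \<zero>\<^bsub>R\<^esub>"
        "x \<star>\<^bsub>M\<^esub> (r \<otimes>\<^bsub>R\<^esub> s) \<in> closure N" .
      let ?p = "r \<otimes>\<^bsub>R\<^esub> s" let ?y = "x \<star>\<^bsub>M\<^esub> ?p"
      have p: "?p \<in> carrier R" using r s by simp
      show "\<exists>s\<in>carrier R. r \<otimes>\<^bsub>R\<^esub> s \<noteq> \<zero>\<^bsub>R\<^esub> \<and> x \<star>\<^bsub>M\<^esub> (r \<otimes>\<^bsub>R\<^esub> s) \<in> N"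
      proof (cases "\<exists>t\<in>carrier R. ?p \<otimes>\<^bsub>R\<^esub> t \<noteq> \<zero>\<^bsub>R\<^esub> \<and> ?y \<star>\<^bsub>M\<^esub> t \<in> N")
        case True
        then obtain t where "t \<in> carrier R" "?p \<otimes>\<^bsub>R\<^esub> t \<noteq> \<zero>\<^bsub>R\<^esub>" "?y \<star>\<^bsub>M\<^esub> t \<in> N" by blast
        then show ?thesis
          using c r s p by (intro bexI[of _ "s \<otimes>\<^bsub>R\<^esub> t"])
            (auto simp: ract_assoc[symmetric] R.m_assoc)
      next
        case False
        have "?y \<in> closure {\<zero>\<^bsub>M\<^esub>}"
        proof (rule closureI)
          show "?y \<in> carrier M" using c p by simp
          fix t assume t: "t \<in> carrier R" "t \<noteq> \<zero>\<^bsub>R\<^esub>"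
          from closureE[OF s(3) t] obtain v where v: "v \<in> carrier R" "t \<otimes>\<^bsub>R\<^esub> v \<noteq> \<zero>\<^bsub>R\<^esub>"
            "?y \<star>\<^bsub>M\<^esub> (t \<otimes>\<^bsub>R\<^esub> v) \<in> N" .
          then have "?p \<otimes>\<^bsub>R\<^esub> (t \<otimes>\<^bsub>R\<^esub> v) = \<zero>\<^bsub>R\<^esub>" using False t by blast
          then have "?y \<star>\<^bsub>M\<^esub> (t \<otimes>\<^bsub>R\<^esub> v) = \<zero>\<^bsub>M\<^esub>"
            using c p t v by (simp only: ract_assoc[symmetric] R.m_closed ract_zero_right)
          then show "\<exists>v\<in>carrier R. t \<otimes>\<^bsub>R\<^esub> v \<noteq> \<zero>\<^bsub>R\<^esub> \<and> ?y \<star>\<^bsub>M\<^esub> (t \<otimes>\<^bsub>R\<^esub> v) \<in> {\<zero>\<^bsub>M\<^esub>}"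
            using v by blast
        qed
        then have "?y = \<zero>\<^bsub>M\<^esub>" using closure_trivial by auto
        then show ?thesis using s N rsubmodule_zero by (intro bexI[of _ s]) auto
      qed
    qed
  qed
qed

lemma closure_least:
  assumes "rsubmodule R M K" "N \<subseteq> closure K" shows "closure N \<subseteq> closure K"
  using closure_mono[OF assms(2)] closure_idem[OF assms(1)] by simp

end

section \<open>Endomorphisms and the closure\<close>

context right_module
begin

lemma endo_add: "\<lbrakk>h \<in> rmodule_endos R M; x \<in> carrier M; y \<in> carrier M\<rbrakk> \<Longrightarrow> h (x \<oplus>\<^bsub>M\<^esub> y) = h x \<oplus>\<^bsub>M\<^esub> h y"
  and endo_ract: "\<lbrakk>h \<in> rmodule_endos R M; x \<in> carrier M; r \<in> carrier R\<rbrakk> \<Longrightarrow> h (x \<star>\<^bsub>M\<^esub> r) = h x \<star>\<^bsub>M\<^esub> r"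
  by (auto simp: rmodule_endos_def)

lemma endo_zero: assumes "h \<in> rmodule_endos R M" shows "h \<zero>\<^bsub>M\<^esub> = \<zero>\<^bsub>M\<^esub>"
  using endo_ract[OF assms M.zero_closed R.zero_closed] rmodule_endos_closed[OF assms] by simp

lemma endo_minus:
  assumes h: "h \<in> rmodule_endos R M" and x: "x \<in> carrier M" shows "h (\<ominus>\<^bsub>M\<^esub> x) = \<ominus>\<^bsub>M\<^esub> h x"
proof -
  have "h (\<ominus>\<^bsub>M\<^esub> x) \<oplus>\<^bsub>M\<^esub> h x = \<zero>\<^bsub>M\<^esub>"
    using x endo_add[OF h, of "\<ominus>\<^bsub>M\<^esub> x" x] by (simp add: M.l_neg endo_zero[OF h])
  then show ?thesis using x rmodule_endos_closed[OF h] by (simp add: M.minus_equality)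
qed

lemma rsubmodule_image:
  assumes h: "h \<in> rmodule_endos R M" and N: "rsubmodule R M N" shows "rsubmodule R M (h ` N)"
proof (rule rsubmoduleI)
  note c = rsubmodule_carrier[OF N]
  show "h ` N \<subseteq> carrier M" using c rmodule_endos_closed[OF h] by auto
  show "\<zero>\<^bsub>M\<^esub> \<in> h ` N" using endo_zero[OF h] rsubmodule_zero[OF N] by force
  show "x \<oplus>\<^bsub>M\<^esub> y \<in> h ` N" if "x \<in> h ` N" "y \<in> h ` N" for x y
    using that c by (auto simp: endo_add[OF h, symmetric] intro!: imageI rsubmodule_add[OF N])
  show "x \<star>\<^bsub>M\<^esub> r \<in> h ` N" if "x \<in> h ` N" "r \<in> carrier R" for x r
    using that c by (auto simp: endo_ract[OF h, symmetric] intro!: imageI rsubmodule_ract[OF N])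
qed

lemma image_sum:
  assumes h: "h \<in> rmodule_endos R M" and N: "rsubmodule R M N" and K: "rsubmodule R M K"
  shows "h ` (N <+>\<^bsub>M\<^esub> K) \<subseteq> h ` N <+>\<^bsub>M\<^esub> h ` K"
proof
  fix y assume "y \<in> h ` (N <+>\<^bsub>M\<^esub> K)"
  then obtain n k where nk: "n \<in> N" "k \<in> K" "y = h (n \<oplus>\<^bsub>M\<^esub> k)" by (auto simp: set_add_def')
  then have "y = h n \<oplus>\<^bsub>M\<^esub> h k"
    using endo_add[OF h] rsubmodule_carrier[OF N] rsubmodule_carrier[OF K] by simp
  then show "y \<in> h ` N <+>\<^bsub>M\<^esub> h ` K" using nk by (auto simp: set_add_def')
qed

lemma image_closure:
  assumes h: "h \<in> rmodule_endos R M" shows "h ` closure N \<subseteq> closure (h ` N)"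
proof
  fix y assume "y \<in> h ` closure N"
  then obtain x where x: "x \<in> closure N" "y = h x" by blast
  note c = closure_carrier[OF x(1)]
  show "y \<in> closure (h ` N)"
  proof (rule closureI)
    show "y \<in> carrier M" using x c rmodule_endos_closed[OF h] by simp
    fix r assume r: "r \<in> carrier R" "r \<noteq> \<zero>\<^bsub>R\<^esub>"
    from closureE[OF x(1) r] obtain s where s: "s \<in> carrier R" "r \<otimes>\<^bsub>R\<^esub> s \<noteq> \<zero>\<^bsub>R\<^esub>"
      "x \<star>\<^bsub>M\<^esub> (r \<otimes>\<^bsub>R\<^esub> s) \<in> N" .
    have "y \<star>\<^bsub>M\<^esub> (r \<otimes>\<^bsub>R\<^esub> s) = h (x \<star>\<^bsub>M\<^esub> (r \<otimes>\<^bsub>R\<^esub> s))"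
      using x c r s by (simp add: endo_ract[OF h])
    then show "\<exists>s\<in>carrier R. r \<otimes>\<^bsub>R\<^esub> s \<noteq> \<zero>\<^bsub>R\<^esub> \<and> y \<star>\<^bsub>M\<^esub> (r \<otimes>\<^bsub>R\<^esub> s) \<in> h ` N"
      using s by blast
  qed
qed

end

context nonsingular_right_module
begin

text \<open>
  Independence survives passing to closures: multiplying a relation by a suitable ring element
  brings both entries down to \<open>A\<close> and \<open>B\<close>, so both entries are killed by essential right
  ideals. With \<open>h\<close> and \<open>k\<close> the identity this says that disjoint submodules have disjoint
  closures; in general it also carries injectivity of \<open>h\<close> on \<open>A\<close> over to \<open>closure A\<close>.
\<close>

lemma independent_closure:
  assumes A: "rsubmodule R M A" and B: "rsubmodule R M B"
    and h: "h \<in> rmodule_endos R M" and k: "k \<in> rmodule_endos R M"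
    and ind: "\<And>a b. \<lbrakk>a \<in> A; b \<in> B; h a \<oplus>\<^bsub>M\<^esub> k b = \<zero>\<^bsub>M\<^esub>\<rbrakk> \<Longrightarrow> a = \<zero>\<^bsub>M\<^esub> \<and> b = \<zero>\<^bsub>M\<^esub>"
    and a: "a \<in> closure A" and b: "b \<in> closure B" and eq: "h a \<oplus>\<^bsub>M\<^esub> k b = \<zero>\<^bsub>M\<^esub>"
  shows "a = \<zero>\<^bsub>M\<^esub> \<and> b = \<zero>\<^bsub>M\<^esub>"
proof -
  note c = closure_carrier[OF a] closure_carrier[OF b]
  have *: "\<exists>s\<in>carrier R. r \<otimes>\<^bsub>R\<^esub> s \<noteq> \<zero>\<^bsub>R\<^esub> \<and> a \<star>\<^bsub>M\<^esub> (r \<otimes>\<^bsub>R\<^esub> s) = \<zero>\<^bsub>M\<^esub> \<and> b \<star>\<^bsub>M\<^esub> (r \<otimes>\<^bsub>R\<^esub> s) = \<zero>\<^bsub>M\<^esub>"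
    if r: "r \<in> carrier R" "r \<noteq> \<zero>\<^bsub>R\<^esub>" for r
  proof -
    from closureE[OF a r] obtain s where s: "s \<in> carrier R" "r \<otimes>\<^bsub>R\<^esub> s \<noteq> \<zero>\<^bsub>R\<^esub>"
      "a \<star>\<^bsub>M\<^esub> (r \<otimes>\<^bsub>R\<^esub> s) \<in> A" .
    have rs: "r \<otimes>\<^bsub>R\<^esub> s \<in> carrier R" using r s by simp
    from closureE[OF b rs s(2)] obtain t where t: "t \<in> carrier R"
      "r \<otimes>\<^bsub>R\<^esub> s \<otimes>\<^bsub>R\<^esub> t \<noteq> \<zero>\<^bsub>R\<^esub>" "b \<star>\<^bsub>M\<^esub> (r \<otimes>\<^bsub>R\<^esub> s \<otimes>\<^bsub>R\<^esub> t) \<in> B" .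
    let ?q = "r \<otimes>\<^bsub>R\<^esub> s \<otimes>\<^bsub>R\<^esub> t"
    have q: "?q \<in> carrier R" using rs t by simp
    have "a \<star>\<^bsub>M\<^esub> ?q \<in> A"
      using c rs t s A by (simp add: ract_assoc[of a "r \<otimes>\<^bsub>R\<^esub> s"] rsubmodule_ract)
    moreover have "h (a \<star>\<^bsub>M\<^esub> ?q) \<oplus>\<^bsub>M\<^esub> k (b \<star>\<^bsub>M\<^esub> ?q) = (h a \<oplus>\<^bsub>M\<^esub> k b) \<star>\<^bsub>M\<^esub> ?q"
      using c q rmodule_endos_closed[OF h] rmodule_endos_closed[OF k]
      by (simp only: endo_ract[OF h] endo_ract[OF k] ract_add_left)
    then have "h (a \<star>\<^bsub>M\<^esub> ?q) \<oplus>\<^bsub>M\<^esub> k (b \<star>\<^bsub>M\<^esub> ?q) = \<zero>\<^bsub>M\<^esub>" using eq q by simp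
    ultimately have "a \<star>\<^bsub>M\<^esub> ?q = \<zero>\<^bsub>M\<^esub> \<and> b \<star>\<^bsub>M\<^esub> ?q = \<zero>\<^bsub>M\<^esub>" using ind t by blast
    then show ?thesis using r s t by (intro bexI[of _ "s \<otimes>\<^bsub>R\<^esub> t"]) (auto simp: R.m_assoc)
  qed
  have "a \<in> closure {\<zero>\<^bsub>M\<^esub>}" by (rule closureI[OF c(1)]) (use * in blast)
  moreover have "b \<in> closure {\<zero>\<^bsub>M\<^esub>}" by (rule closureI[OF c(2)]) (use * in blast)
  ultimately show ?thesis using closure_trivial by blast
qed

end

section \<open>Clean pairs\<close>

locale complementary_endos = nonsingular_right_module R M
  for R :: "('r, 'a) ring_scheme" (structure) and M :: "('r, 'm, 'z) rmodule_scheme" (structure) +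
  fixes f g :: "'m \<Rightarrow> 'm"
  assumes f: "f \<in> rmodule_endos R M" and g: "g \<in> rmodule_endos R M"
    and f_plus_g: "x \<in> carrier M \<Longrightarrow> f x \<oplus>\<^bsub>M\<^esub> g x = x"
begin

lemmas f_closed [simp] = rmodule_endos_closed[OF f]
lemmas g_closed [simp] = rmodule_endos_closed[OF g]
lemmas hom_simps = endo_add[OF f] endo_add[OF g] endo_zero[OF f] endo_zero[OF g]
  endo_minus[OF f] endo_minus[OF g]

lemma f_g_commute: assumes x: "x \<in> carrier M" shows "f (g x) = g (f x)"
proof -
  have "f (f x) \<oplus>\<^bsub>M\<^esub> f (g x) = f (f x) \<oplus>\<^bsub>M\<^esub> g (f x)"
    using x f_plus_g[of x] f_plus_g[of "f x"] hom_simps(1)[of "f x" "g x"] by simp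
  then show ?thesis using x by simp
qed

text \<open>
  The two independence conditions are written so that they have one shape. The first says
  \<open>A \<inter> B = 0\<close>. The second says that \<open>f\<close> is injective on \<open>A\<close>, \<open>g\<close> is injective on \<open>B\<close>, and
  \<open>f A \<inter> g B = 0\<close>; equivalently, the map \<open>a + b \<mapsto> f a - g b\<close> is injective on \<open>A + B\<close>.
  The last condition says that this map is an automorphism of \<open>A + B\<close> up to essential
  extensions.
\<close>

definition clean_pair :: "'m set \<Rightarrow> 'm set \<Rightarrow> bool"
  where "clean_pair A B \<longleftrightarrow> rsubmodule R M A \<and> rsubmodule R M B \<and>
    (\<forall>a\<in>A. \<forall>b\<in>B. a \<oplus>\<^bsub>M\<^esub> b = \<zero>\<^bsub>M\<^esub> \<longrightarrow> a = \<zero>\<^bsub>M\<^esub> \<and> b = \<zero>\<^bsub>M\<^esub>) \<and>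
    (\<forall>a\<in>A. \<forall>b\<in>B. f a \<oplus>\<^bsub>M\<^esub> g b = \<zero>\<^bsub>M\<^esub> \<longrightarrow> a = \<zero>\<^bsub>M\<^esub> \<and> b = \<zero>\<^bsub>M\<^esub>) \<and>
    closure (A <+>\<^bsub>M\<^esub> B) = closure (f ` A <+>\<^bsub>M\<^esub> g ` B)"

lemma clean_pair_submodules:
  assumes "clean_pair A B"
  shows "rsubmodule R M A" "rsubmodule R M B" "rsubmodule R M (A <+>\<^bsub>M\<^esub> B)"
    "rsubmodule R M (f ` A <+>\<^bsub>M\<^esub> g ` B)" "rsubmodule R M (closure (A <+>\<^bsub>M\<^esub> B))"
  using assms by (auto simp: clean_pair_def f g rsubmodule_sum rsubmodule_image rsubmodule_closure)

lemma clean_pair_subset_closure: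
  assumes P: "clean_pair A B"
  shows "A \<subseteq> closure (A <+>\<^bsub>M\<^esub> B)" "B \<subseteq> closure (A <+>\<^bsub>M\<^esub> B)"
    "f ` A \<subseteq> closure (A <+>\<^bsub>M\<^esub> B)" "g ` B \<subseteq> closure (A <+>\<^bsub>M\<^esub> B)"
proof -
  note s = clean_pair_submodules[OF P]
  show "A \<subseteq> closure (A <+>\<^bsub>M\<^esub> B)" "B \<subseteq> closure (A <+>\<^bsub>M\<^esub> B)"
    using sum_subset_left[OF s(1,2)] sum_subset_right[OF s(1,2)] subset_closure[OF s(3)] by auto
  have "f ` A \<subseteq> closure (f ` A <+>\<^bsub>M\<^esub> g ` B)" "g ` B \<subseteq> closure (f ` A <+>\<^bsub>M\<^esub> g ` B)"
    using sum_subset_left[OF rsubmodule_image[OF f s(1)] rsubmodule_image[OF g s(2)]]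
      sum_subset_right[OF rsubmodule_image[OF f s(1)] rsubmodule_image[OF g s(2)]]
      subset_closure[OF s(4)] by auto
  then show "f ` A \<subseteq> closure (A <+>\<^bsub>M\<^esub> B)" "g ` B \<subseteq> closure (A <+>\<^bsub>M\<^esub> B)"
    using P by (auto simp: clean_pair_def)
qed

text \<open>
  On \<open>A\<close> the map \<open>f\<close> lands in the closure by definition; on \<open>B\<close> it does because \<open>f b = b - g b\<close>.
\<close>

lemma clean_pair_closure_invariant:
  assumes P: "clean_pair A B" and x: "x \<in> closure (A <+>\<^bsub>M\<^esub> B)"
  shows "f x \<in> closure (A <+>\<^bsub>M\<^esub> B)" "g x \<in> closure (A <+>\<^bsub>M\<^esub> B)"
proof -
  let ?W = "closure (A <+>\<^bsub>M\<^esub> B)"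
  note s = clean_pair_submodules[OF P] and sc = clean_pair_subset_closure[OF P]
  have "f ` (A <+>\<^bsub>M\<^esub> B) \<subseteq> ?W"
  proof
    fix y assume "y \<in> f ` (A <+>\<^bsub>M\<^esub> B)"
    then obtain a b where ab: "a \<in> A" "b \<in> B" "y = f (a \<oplus>\<^bsub>M\<^esub> b)" by (auto simp: set_add_def')
    note c = rsubmodule_carrier[OF s(1) ab(1)] rsubmodule_carrier[OF s(2) ab(2)]
    have "g b \<oplus>\<^bsub>M\<^esub> f b \<in> ?W" using f_plus_g[of b] c sc ab by (auto simp: M.a_comm)
    then have "f b \<in> ?W" using rsubmodule_add_cancel[OF s(5), of "g b" "f b"] c sc ab by auto
    then show "y \<in> ?W" using ab c sc rsubmodule_add[OF s(5)] by (auto simp: hom_simps)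
  qed
  then have "closure (f ` (A <+>\<^bsub>M\<^esub> B)) \<subseteq> ?W" by (rule closure_least[OF s(3)])
  then show fx: "f x \<in> ?W" using image_closure[OF f] x by blast
  have c: "x \<in> carrier M" using x closure_carrier by blast
  show "g x \<in> ?W"
    using rsubmodule_add_cancel[OF s(5) fx, of "g x"] c x by (simp add: f_plus_g)
qed

text \<open>
  A clean pair \<open>(A1, B1)\<close> modulo the invariant closed submodule \<open>W\<close> spanned by \<open>(A, B)\<close> lifts
  to a clean pair in \<open>M\<close>: in any relation the components from \<open>A1\<close> and \<open>B1\<close> vanish modulo
  \<open>W\<close>, hence vanish, and the rest is a relation for \<open>(A, B)\<close>. Stating this with
  hypotheses relative to \<open>W\<close> takes the place of working in \<open>M/W\<close>.
\<close>

lemma clean_pair_sum: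
  assumes P: "clean_pair A B" and W_def: "W = closure (A <+>\<^bsub>M\<^esub> B)"
    and A1: "rsubmodule R M A1" and B1: "rsubmodule R M B1"
    and ind: "\<And>a b. \<lbrakk>a \<in> A1; b \<in> B1; a \<oplus>\<^bsub>M\<^esub> b \<in> W\<rbrakk> \<Longrightarrow> a = \<zero>\<^bsub>M\<^esub> \<and> b = \<zero>\<^bsub>M\<^esub>"
    and ind': "\<And>a b. \<lbrakk>a \<in> A1; b \<in> B1; f a \<oplus>\<^bsub>M\<^esub> g b \<in> W\<rbrakk> \<Longrightarrow> a = \<zero>\<^bsub>M\<^esub> \<and> b = \<zero>\<^bsub>M\<^esub>"
    and cl: "A1 \<subseteq> closure (W <+>\<^bsub>M\<^esub> (f ` A1 <+>\<^bsub>M\<^esub> g ` B1))"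
      "B1 \<subseteq> closure (W <+>\<^bsub>M\<^esub> (f ` A1 <+>\<^bsub>M\<^esub> g ` B1))"
    and cl': "f ` A1 \<subseteq> closure (W <+>\<^bsub>M\<^esub> (A1 <+>\<^bsub>M\<^esub> B1))"
      "g ` B1 \<subseteq> closure (W <+>\<^bsub>M\<^esub> (A1 <+>\<^bsub>M\<^esub> B1))"
  shows "clean_pair (A <+>\<^bsub>M\<^esub> A1) (B <+>\<^bsub>M\<^esub> B1)"
proof -
  note s = clean_pair_submodules[OF P, folded W_def]
    and sc = clean_pair_subset_closure[OF P, folded W_def]
  note c = rsubmodule_carrier[OF s(1)] rsubmodule_carrier[OF s(2)]
    rsubmodule_carrier[OF A1] rsubmodule_carrier[OF B1]
  note i1 = rsubmodule_image[OF f A1] rsubmodule_image[OF g B1]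
  let ?A = "A <+>\<^bsub>M\<^esub> A1" and ?B = "B <+>\<^bsub>M\<^esub> B1"
  have sA: "rsubmodule R M ?A" and sB: "rsubmodule R M ?B"
    using s A1 B1 by (auto intro: rsubmodule_sum)
  have sD: "rsubmodule R M (f ` ?A <+>\<^bsub>M\<^esub> g ` ?B)" and sAB: "rsubmodule R M (?A <+>\<^bsub>M\<^esub> ?B)"
    using sA sB by (auto intro: rsubmodule_sum rsubmodule_image f g)
  note subs = sum_subset_left[OF s(1) A1] sum_subset_right[OF s(1) A1]
    sum_subset_left[OF s(2) B1] sum_subset_right[OF s(2) B1]
  have indep: "x = \<zero>\<^bsub>M\<^esub> \<and> y = \<zero>\<^bsub>M\<^esub>" if x: "x \<in> ?A" and y: "y \<in> ?B" and eq: "x \<oplus>\<^bsub>M\<^esub> y = \<zero>\<^bsub>M\<^esub>" for x y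
  proof -
    obtain a a1 where a: "a \<in> A" "a1 \<in> A1" "x = a \<oplus>\<^bsub>M\<^esub> a1" using x by (auto simp: set_add_def')
    obtain b b1 where b: "b \<in> B" "b1 \<in> B1" "y = b \<oplus>\<^bsub>M\<^esub> b1" using y by (auto simp: set_add_def')
    note cc = c(1)[OF a(1)] c(3)[OF a(2)] c(2)[OF b(1)] c(4)[OF b(2)]
    have "(a \<oplus>\<^bsub>M\<^esub> b) \<oplus>\<^bsub>M\<^esub> (a1 \<oplus>\<^bsub>M\<^esub> b1) = \<zero>\<^bsub>M\<^esub>" using eq cc a b by (simp add: M.a_ac)
    moreover have "a \<oplus>\<^bsub>M\<^esub> b \<in> W" using sc a b rsubmodule_add[OF s(5)] by blast
    ultimately have "a1 \<oplus>\<^bsub>M\<^esub> b1 \<in> W"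
      using rsubmodule_add_cancel[OF s(5)] cc rsubmodule_zero[OF s(5)] by (metis M.a_closed)
    then have "a1 = \<zero>\<^bsub>M\<^esub>" "b1 = \<zero>\<^bsub>M\<^esub>" using ind a b by auto
    moreover have "a = \<zero>\<^bsub>M\<^esub> \<and> b = \<zero>\<^bsub>M\<^esub>"
      using P a b eq calculation cc by (auto simp: clean_pair_def)
    ultimately show ?thesis using a b by simp
  qed
  have indep': "x = \<zero>\<^bsub>M\<^esub> \<and> y = \<zero>\<^bsub>M\<^esub>" if x: "x \<in> ?A" and y: "y \<in> ?B" and eq: "f x \<oplus>\<^bsub>M\<^esub> g y = \<zero>\<^bsub>M\<^esub>" for x y
  proof -
    obtain a a1 where a: "a \<in> A" "a1 \<in> A1" "x = a \<oplus>\<^bsub>M\<^esub> a1" using x by (auto simp: set_add_def')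
    obtain b b1 where b: "b \<in> B" "b1 \<in> B1" "y = b \<oplus>\<^bsub>M\<^esub> b1" using y by (auto simp: set_add_def')
    note cc = c(1)[OF a(1)] c(3)[OF a(2)] c(2)[OF b(1)] c(4)[OF b(2)]
    have "(f a \<oplus>\<^bsub>M\<^esub> g b) \<oplus>\<^bsub>M\<^esub> (f a1 \<oplus>\<^bsub>M\<^esub> g b1) = \<zero>\<^bsub>M\<^esub>"
      using eq cc a b by (simp add: hom_simps M.a_ac)
    moreover have "f a \<oplus>\<^bsub>M\<^esub> g b \<in> W" using sc a b rsubmodule_add[OF s(5)] by blast
    ultimately have "f a1 \<oplus>\<^bsub>M\<^esub> g b1 \<in> W"
      using rsubmodule_add_cancel[OF s(5)] cc rsubmodule_zero[OF s(5)]
      by (metis M.a_closed f_closed g_closed)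
    then have "a1 = \<zero>\<^bsub>M\<^esub>" "b1 = \<zero>\<^bsub>M\<^esub>" using ind' a b by auto
    moreover have "a = \<zero>\<^bsub>M\<^esub> \<and> b = \<zero>\<^bsub>M\<^esub>"
      using P a b eq calculation cc by (auto simp: clean_pair_def)
    ultimately show ?thesis using a b by simp
  qed
  have W_D: "W = closure (f ` A <+>\<^bsub>M\<^esub> g ` B)" using P W_def by (auto simp: clean_pair_def)
  have W1: "W \<subseteq> closure (f ` ?A <+>\<^bsub>M\<^esub> g ` ?B)"
    unfolding W_D by (intro closure_mono set_add_mono image_mono subs)
  have W2: "W \<subseteq> closure (?A <+>\<^bsub>M\<^esub> ?B)"
    unfolding W_def by (intro closure_mono set_add_mono subs)
  have "f ` A1 <+>\<^bsub>M\<^esub> g ` B1 \<subseteq> closure (f ` ?A <+>\<^bsub>M\<^esub> g ` ?B)"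
    by (rule order_trans[OF _ subset_closure[OF sD]]) (intro set_add_mono image_mono subs)
  then have D1: "closure (W <+>\<^bsub>M\<^esub> (f ` A1 <+>\<^bsub>M\<^esub> g ` B1)) \<subseteq> closure (f ` ?A <+>\<^bsub>M\<^esub> g ` ?B)"
    by (rule closure_least[OF sD sum_least[OF rsubmodule_closure[OF sD] W1]])
  have "A1 <+>\<^bsub>M\<^esub> B1 \<subseteq> closure (?A <+>\<^bsub>M\<^esub> ?B)"
    by (rule order_trans[OF _ subset_closure[OF sAB]]) (intro set_add_mono subs)
  then have D2: "closure (W <+>\<^bsub>M\<^esub> (A1 <+>\<^bsub>M\<^esub> B1)) \<subseteq> closure (?A <+>\<^bsub>M\<^esub> ?B)"
    by (rule closure_least[OF sAB sum_least[OF rsubmodule_closure[OF sAB] W2]])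
  have c1: "?A \<subseteq> closure (f ` ?A <+>\<^bsub>M\<^esub> g ` ?B)" "?B \<subseteq> closure (f ` ?A <+>\<^bsub>M\<^esub> g ` ?B)"
    by (rule sum_least[OF rsubmodule_closure[OF sD] order_trans[OF sc(1) W1] order_trans[OF cl(1) D1]]
        sum_least[OF rsubmodule_closure[OF sD] order_trans[OF sc(2) W1] order_trans[OF cl(2) D1]])+
  note cAB = rsubmodule_closure[OF sAB]
  have c2: "f ` ?A <+>\<^bsub>M\<^esub> g ` ?B \<subseteq> closure (?A <+>\<^bsub>M\<^esub> ?B)"
  proof (rule sum_least[OF cAB])
    show "f ` ?A \<subseteq> closure (?A <+>\<^bsub>M\<^esub> ?B)"
      by (rule order_trans[OF image_sum[OF f s(1) A1]
            sum_least[OF cAB order_trans[OF sc(3) W2] order_trans[OF cl'(1) D2]]])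
    show "g ` ?B \<subseteq> closure (?A <+>\<^bsub>M\<^esub> ?B)"
      by (rule order_trans[OF image_sum[OF g s(2) B1]
            sum_least[OF cAB order_trans[OF sc(4) W2] order_trans[OF cl'(2) D2]]])
  qed
  have "closure (?A <+>\<^bsub>M\<^esub> ?B) = closure (f ` ?A <+>\<^bsub>M\<^esub> g ` ?B)"
    by (rule equalityI[OF closure_least[OF sD sum_least[OF rsubmodule_closure[OF sD] c1]]
          closure_least[OF sAB c2]])
  then show ?thesis using sA sB indep indep' unfolding clean_pair_def by blast
qed

lemma clean_pair_properly_extends:
  assumes P: "clean_pair A B" and W_def: "W = closure (A <+>\<^bsub>M\<^esub> B)"
    and A1: "rsubmodule R M A1" and B1: "rsubmodule R M B1"
    and ind: "\<And>a b. \<lbrakk>a \<in> A1; b \<in> B1; a \<oplus>\<^bsub>M\<^esub> b \<in> W\<rbrakk> \<Longrightarrow> a = \<zero>\<^bsub>M\<^esub> \<and> b = \<zero>\<^bsub>M\<^esub>"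
    and ne: "A1 \<noteq> {\<zero>\<^bsub>M\<^esub>} \<or> B1 \<noteq> {\<zero>\<^bsub>M\<^esub>}"
    and P': "clean_pair (A <+>\<^bsub>M\<^esub> A1) (B <+>\<^bsub>M\<^esub> B1)"
  shows "\<exists>A' B'. clean_pair A' B' \<and> A \<subseteq> A' \<and> B \<subseteq> B' \<and> (A', B') \<noteq> (A, B)"
proof -
  note s = clean_pair_submodules[OF P] and sc = clean_pair_subset_closure[OF P]
  have "a = \<zero>\<^bsub>M\<^esub>" if "A <+>\<^bsub>M\<^esub> A1 = A" and a: "a \<in> A1" for a
  proof -
    have "a \<in> W" using sum_subset_right[OF s(1) A1] that sc(1) unfolding W_def by blast
    then show ?thesis
      using ind[OF a rsubmodule_zero[OF B1]] rsubmodule_carrier[OF A1 a] by simp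
  qed
  moreover have "b = \<zero>\<^bsub>M\<^esub>" if "B <+>\<^bsub>M\<^esub> B1 = B" and b: "b \<in> B1" for b
  proof -
    have "b \<in> W" using sum_subset_right[OF s(2) B1] that sc(2) unfolding W_def by blast
    then show ?thesis
      using ind[OF rsubmodule_zero[OF A1] b] rsubmodule_carrier[OF B1 b] by simp
  qed
  ultimately have "(A <+>\<^bsub>M\<^esub> A1, B <+>\<^bsub>M\<^esub> B1) \<noteq> (A, B)"
    using ne rsubmodule_zero[OF A1] rsubmodule_zero[OF B1] by auto
  then show ?thesis
    using P' sum_subset_left[OF s(1) A1] sum_subset_left[OF s(2) B1] by blast
qed

section \<open>Enlarging a clean pair\<close>

text \<open>
  On the kernel of \<open>f\<close> modulo \<open>W\<close> the map \<open>g\<close> is the identity modulo \<open>W\<close>, so every submodule of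
  that kernel disjoint from \<open>W\<close> can be added to \<open>B\<close>; a nonzero cyclic one suffices.
\<close>

lemma clean_pair_extend_kernel:
  assumes P: "clean_pair A B" and W_def: "W = closure (A <+>\<^bsub>M\<^esub> B)"
    and x: "x \<in> carrier M" "x \<notin> W" "f x \<in> W"
  shows "\<exists>A' B'. clean_pair A' B' \<and> A \<subseteq> A' \<and> B \<subseteq> B' \<and> (A', B') \<noteq> (A, B)"
proof -
  note s = clean_pair_submodules[OF P, folded W_def]
  have W: "rsubmodule R M W" using s by simp
  have "closure W = W" using closure_idem[OF s(3)] W_def by simp
  then obtain r where r: "r \<in> carrier R" "x \<star>\<^bsub>M\<^esub> r \<noteq> \<zero>\<^bsub>M\<^esub>"
    and disj: "(\<lambda>s. (x \<star>\<^bsub>M\<^esub> r) \<star>\<^bsub>M\<^esub> s) ` carrier R \<inter> W = {\<zero>\<^bsub>M\<^esub>}"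
    using not_in_closure[OF W x(1)] x(2) by metis
  define L where "L = (\<lambda>s. (x \<star>\<^bsub>M\<^esub> r) \<star>\<^bsub>M\<^esub> s) ` carrier R"
  have L: "rsubmodule R M L" using rsubmodule_cyclic[of "x \<star>\<^bsub>M\<^esub> r"] x r by (simp add: L_def)
  note c = rsubmodule_carrier[OF L]
  have LW: "l = \<zero>\<^bsub>M\<^esub>" if "l \<in> L" "l \<in> W" for l using disj that by (auto simp: L_def)
  have fL: "f l \<in> W" if "l \<in> L" for l
    using that x r by (auto simp: L_def endo_ract[OF f] intro!: rsubmodule_ract[OF W])
  have gL: "l \<in> W" if "l \<in> L" "g l \<in> W" for l
    using rsubmodule_add[OF W fL[OF that(1)] that(2)] f_plus_g[OF c[OF that(1)]] by simp
  note Z = rsubmodule_trivial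
  have sub: "rsubmodule R M (W <+>\<^bsub>M\<^esub> (f ` {\<zero>\<^bsub>M\<^esub>} <+>\<^bsub>M\<^esub> g ` L))" (is "rsubmodule R M ?D")
    and sub': "rsubmodule R M (W <+>\<^bsub>M\<^esub> ({\<zero>\<^bsub>M\<^esub>} <+>\<^bsub>M\<^esub> L))" (is "rsubmodule R M ?E")
    by (intro rsubmodule_sum rsubmodule_image f g W L Z)+
  note img = rsubmodule_image[OF f Z] rsubmodule_image[OF g L]
  have WD: "W \<subseteq> ?D" "g ` L \<subseteq> ?D"
    using sum_subset_left[OF W rsubmodule_sum[OF img]] sum_subset_right[OF W rsubmodule_sum[OF img]]
      sum_subset_right[OF img] by auto
  have WE: "W \<subseteq> ?E" "L \<subseteq> ?E"
    using sum_subset_left[OF W rsubmodule_sum[OF Z L]] sum_subset_right[OF W rsubmodule_sum[OF Z L]]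
      sum_subset_right[OF Z L] by auto
  have "l \<in> ?D" if "l \<in> L" for l
    using rsubmodule_add[OF sub, of "f l" "g l"] WD fL[OF that] that f_plus_g[OF c[OF that]] by auto
  moreover have "g l \<in> ?E" if "l \<in> L" for l
    using rsubmodule_add_cancel[OF sub', of "f l" "g l"] WE fL[OF that] that f_plus_g[OF c[OF that]]
      c[OF that] by auto
  ultimately have "clean_pair (A <+>\<^bsub>M\<^esub> {\<zero>\<^bsub>M\<^esub>}) (B <+>\<^bsub>M\<^esub> L)"
    using W LW gL c subset_closure[OF sub] subset_closure[OF sub']
      rsubmodule_zero[OF rsubmodule_closure[OF sub]] rsubmodule_zero[OF rsubmodule_closure[OF sub']]
    by (intro clean_pair_sum[OF P W_def Z L]) (auto simp: hom_simps)
  moreover have "L \<noteq> {\<zero>\<^bsub>M\<^esub>}"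
    using r x by (force simp: L_def intro!: image_eqI[of _ _ "\<one>\<^bsub>R\<^esub>"])
  ultimately show ?thesis
    using clean_pair_properly_extends[OF P W_def Z L] LW c by auto
qed

text \<open>
  Put \<open>t = f g = f - f\<^sup>2\<close>. The set \<open>shift_span L n\<close> is \<open>L + t L + \<dots> + t\<^sup>n\<^sup>-\<^sup>1 L\<close>.
  When \<open>f\<close> is injective and the submodules \<open>f\<^sup>i L\<close> are independent, their sum is a polynomial
  module \<open>L[x]\<close> on which \<open>f\<close> acts as multiplication by \<open>x\<close>, and \<open>L[x] = L[t] \<oplus> x L[t]\<close> with
  \<open>t = x - x\<^sup>2\<close>. The union \<open>S\<close> of the sets \<open>shift_span L n\<close> is then \<open>L[t]\<close>.
\<close>

primrec shift_span :: "'m set \<Rightarrow> nat \<Rightarrow> 'm set"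
  where "shift_span L 0 = {\<zero>\<^bsub>M\<^esub>}"
  | "shift_span L (Suc n) = L <+>\<^bsub>M\<^esub> (\<lambda>s. f (g s)) ` shift_span L n"

lemma rsubmodule_fg: "rsubmodule R M N \<Longrightarrow> rsubmodule R M ((\<lambda>s. f (g s)) ` N)"
  using rsubmodule_image[OF f rsubmodule_image[OF g]] by (simp add: image_image)

lemma rsubmodule_shift_span: "rsubmodule R M L \<Longrightarrow> rsubmodule R M (shift_span L n)"
  by (induction n) (auto intro!: rsubmodule_sum rsubmodule_trivial rsubmodule_fg)

lemma shift_span_fg:
  "\<lbrakk>rsubmodule R M L; s \<in> shift_span L n\<rbrakk> \<Longrightarrow> f (g s) \<in> shift_span L (Suc n)"
  using sum_subset_right[OF _ rsubmodule_fg[OF rsubmodule_shift_span[of L n]], of L] by auto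

lemma shift_span_Suc: assumes L: "rsubmodule R M L" shows "shift_span L n \<subseteq> shift_span L (Suc n)"
proof (induction n)
  case 0
  show ?case using rsubmodule_zero[OF rsubmodule_shift_span[OF L, of "Suc 0"]] by simp
next
  case (Suc n)
  show ?case
    using set_add_mono[OF order_refl[of L] image_mono[OF Suc]] by (simp only: shift_span.simps)
qed

text \<open>
  The directness of \<open>S + x S\<close> modulo \<open>W\<close>. In a relation \<open>l + f g t + f s' \<in> W\<close> with \<open>l \<in> L\<close> the
  term \<open>l\<close> vanishes because \<open>L\<close> is disjoint from \<open>f M + W\<close>, and \<open>f\<close> can be cancelled, leaving
  \<open>g t + s' \<in> W\<close>. Since \<open>g t = t - f t\<close>, this is the relation \<open>(s' + t) + f (- t) \<in> W\<close> of the
  original form, now with fewer terms.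
\<close>

lemma shift_span_independent:
  assumes W: "rsubmodule R M W" and L: "rsubmodule R M L"
    and inj: "\<And>x. \<lbrakk>x \<in> carrier M; f x \<in> W\<rbrakk> \<Longrightarrow> x \<in> W"
    and disj: "\<And>l x. \<lbrakk>l \<in> L; x \<in> carrier M; l \<oplus>\<^bsub>M\<^esub> f x \<in> W\<rbrakk> \<Longrightarrow> l = \<zero>\<^bsub>M\<^esub> \<and> x \<in> W"
  shows "\<lbrakk>s \<in> shift_span L n; s' \<in> shift_span L n; s \<oplus>\<^bsub>M\<^esub> f s' \<in> W\<rbrakk> \<Longrightarrow> s = \<zero>\<^bsub>M\<^esub> \<and> s' = \<zero>\<^bsub>M\<^esub>"
proof -
  define ind where "ind N K \<longleftrightarrow> (\<forall>s\<in>N. \<forall>s'\<in>K. s \<oplus>\<^bsub>M\<^esub> f s' \<in> W \<longrightarrow> s = \<zero>\<^bsub>M\<^esub> \<and> s' = \<zero>\<^bsub>M\<^esub>)" for N K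
  have step: "ind (L <+>\<^bsub>M\<^esub> (\<lambda>s. f (g s)) ` N) K"
    if JN: "ind J N" and J: "rsubmodule R M J" and N: "rsubmodule R M N" and sub: "N \<subseteq> J" "K \<subseteq> J" for J N K
    unfolding ind_def
  proof (intro ballI impI)
    fix s s' assume "s \<in> L <+>\<^bsub>M\<^esub> (\<lambda>s. f (g s)) ` N" and s': "s' \<in> K" and sW: "s \<oplus>\<^bsub>M\<^esub> f s' \<in> W"
    then obtain l t where lt: "l \<in> L" "t \<in> N" "s = l \<oplus>\<^bsub>M\<^esub> f (g t)" by (auto simp: set_add_def')
    have c: "l \<in> carrier M" "t \<in> carrier M" "s' \<in> carrier M"
      using lt s' sub J rsubmodule_carrier L by blast+
    have "s \<oplus>\<^bsub>M\<^esub> f s' = l \<oplus>\<^bsub>M\<^esub> f (g t \<oplus>\<^bsub>M\<^esub> s')" using c lt by (simp add: hom_simps M.a_assoc)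
    then have l: "l = \<zero>\<^bsub>M\<^esub>" "g t \<oplus>\<^bsub>M\<^esub> s' \<in> W" using disj[OF lt(1), of "g t \<oplus>\<^bsub>M\<^esub> s'"] sW c by auto
    have "(s' \<oplus>\<^bsub>M\<^esub> t) \<oplus>\<^bsub>M\<^esub> f (\<ominus>\<^bsub>M\<^esub> t) = (s' \<oplus>\<^bsub>M\<^esub> (f t \<oplus>\<^bsub>M\<^esub> g t)) \<oplus>\<^bsub>M\<^esub> \<ominus>\<^bsub>M\<^esub> f t"
      using c by (simp add: f_plus_g hom_simps)
    also have "\<dots> = (f t \<oplus>\<^bsub>M\<^esub> \<ominus>\<^bsub>M\<^esub> f t) \<oplus>\<^bsub>M\<^esub> (g t \<oplus>\<^bsub>M\<^esub> s')" using c by (simp add: M.a_ac)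
    also have "\<dots> = g t \<oplus>\<^bsub>M\<^esub> s'" using c by (simp add: M.r_neg)
    finally have "(s' \<oplus>\<^bsub>M\<^esub> t) \<oplus>\<^bsub>M\<^esub> f (\<ominus>\<^bsub>M\<^esub> t) \<in> W" using l by simp
    moreover have "s' \<oplus>\<^bsub>M\<^esub> t \<in> J" "\<ominus>\<^bsub>M\<^esub> t \<in> N"
      using lt s' sub rsubmodule_add[OF J] rsubmodule_minus[OF N] by auto
    ultimately have "s' \<oplus>\<^bsub>M\<^esub> t = \<zero>\<^bsub>M\<^esub> \<and> \<ominus>\<^bsub>M\<^esub> t = \<zero>\<^bsub>M\<^esub>" using JN unfolding ind_def by blast
    then have "t = \<zero>\<^bsub>M\<^esub>" "s' = \<zero>\<^bsub>M\<^esub>" using c by (auto simp: M.add.inv_eq_1_iff)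
    then show "s = \<zero>\<^bsub>M\<^esub> \<and> s' = \<zero>\<^bsub>M\<^esub>" using lt l by (simp add: hom_simps)
  qed
  note S = rsubmodule_shift_span[OF L]
  \<comment> \<open>One step passes from \<open>(n, n)\<close> terms to \<open>(n + 1, n)\<close>, a second one to \<open>(n + 1, n + 1)\<close>.\<close>
  have "ind (shift_span L n) (shift_span L n)"
  proof (induction n)
    case 0 show ?case by (simp add: ind_def)
  next
    case (Suc n)
    have "ind (shift_span L (Suc n)) (shift_span L n)"
      using step[OF Suc S S] by simp
    from step[OF this S S shift_span_Suc[OF L] order_refl] show ?case by simp
  qed
  then show "\<lbrakk>s \<in> shift_span L n; s' \<in> shift_span L n; s \<oplus>\<^bsub>M\<^esub> f s' \<in> W\<rbrakk> \<Longrightarrow> s = \<zero>\<^bsub>M\<^esub> \<and> s' = \<zero>\<^bsub>M\<^esub>"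
    unfolding ind_def by blast
qed

text \<open>
  If \<open>f\<close> is injective modulo \<open>W\<close> but \<open>f M + W\<close> is not essential, a nonzero \<open>L\<close> disjoint from
  \<open>f M + W\<close> generates a one-sided shift \<open>L[x]\<close>. A shift is clean: over \<open>\<int>[t]\<close> the idempotent
  with \<open>1 \<mapsto> 1 + x\<close> and \<open>x \<mapsto> 0\<close> differs from multiplication by \<open>x\<close> by the
  map \<open>1 \<mapsto> -1\<close>, \<open>x \<mapsto> x\<^sup>2 = x - t\<close>, which is triangular with unit diagonal. Its kernel and
  image give \<open>A1 = x S\<close> and \<open>B1 = (1 + x) S\<close>, and correspondingly
  \<open>x A1 \<oplus> (1 - x) B1 = x\<^sup>2 S \<oplus> (1 - x\<^sup>2) S = S \<oplus> x S\<close>.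
\<close>

lemma clean_pair_extend_shift:
  assumes P: "clean_pair A B" and W_def: "W = closure (A <+>\<^bsub>M\<^esub> B)"
    and inj: "\<And>x. \<lbrakk>x \<in> carrier M; f x \<in> W\<rbrakk> \<Longrightarrow> x \<in> W"
    and nd: "closure (f ` carrier M <+>\<^bsub>M\<^esub> W) \<noteq> carrier M"
  shows "\<exists>A' B'. clean_pair A' B' \<and> A \<subseteq> A' \<and> B \<subseteq> B' \<and> (A', B') \<noteq> (A, B)"
proof -
  note s = clean_pair_submodules[OF P, folded W_def]
  have W: "rsubmodule R M W" using s by simp
  let ?F = "f ` carrier M <+>\<^bsub>M\<^esub> W"
  have F: "rsubmodule R M ?F" using W by (intro rsubmodule_sum rsubmodule_image f rsubmodule_all)
  obtain y where y: "y \<in> carrier M" "y \<notin> closure ?F" using nd closure_carrier by blast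
  obtain r where r: "r \<in> carrier R" "y \<star>\<^bsub>M\<^esub> r \<noteq> \<zero>\<^bsub>M\<^esub>"
    and LF: "(\<lambda>s. (y \<star>\<^bsub>M\<^esub> r) \<star>\<^bsub>M\<^esub> s) ` carrier R \<inter> ?F = {\<zero>\<^bsub>M\<^esub>}"
    using not_in_closure[OF F y] by metis
  define L where "L = (\<lambda>s. (y \<star>\<^bsub>M\<^esub> r) \<star>\<^bsub>M\<^esub> s) ` carrier R"
  have L: "rsubmodule R M L" using rsubmodule_cyclic[of "y \<star>\<^bsub>M\<^esub> r"] y r by (simp add: L_def)
  have L0: "y \<star>\<^bsub>M\<^esub> r \<in> L"
    using r y by (force simp: L_def intro!: image_eqI[of _ _ "\<one>\<^bsub>R\<^esub>"])
  have disj: "l = \<zero>\<^bsub>M\<^esub> \<and> x \<in> W" if l: "l \<in> L" and x: "x \<in> carrier M" and lx: "l \<oplus>\<^bsub>M\<^esub> f x \<in> W" for l x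
  proof -
    have c: "l \<in> carrier M" using l L rsubmodule_carrier by blast
    have FW: "f ` carrier M \<subseteq> ?F" "W \<subseteq> ?F"
      using sum_subset_left sum_subset_right rsubmodule_image[OF f rsubmodule_all] W by blast+
    then have "l \<in> ?F"
      using rsubmodule_add_cancel[OF F, of "f x" l] x lx c by (auto simp: M.a_comm)
    then have "l = \<zero>\<^bsub>M\<^esub>" using LF l by (auto simp: L_def)
    then show ?thesis using inj x lx by simp
  qed
  define S where "S = (\<Union>n. shift_span L n)"
  note Sn = rsubmodule_shift_span[OF L]
  have mono: "shift_span L m \<subseteq> shift_span L n" if "m \<le> n" for m n
    by (rule lift_Suc_mono_le[of "shift_span L", OF shift_span_Suc[OF L] that])
  have S: "rsubmodule R M S"
    unfolding S_def
  proof (rule rsubmodule_Union_chain)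
    fix N K assume "N \<in> range (shift_span L)" "K \<in> range (shift_span L)"
    then obtain m n where "N = shift_span L m" "K = shift_span L n" by blast
    then show "N \<subseteq> K \<or> K \<subseteq> N" using mono[of m n] mono[of n m] nat_le_linear[of m n] by blast
  qed (use Sn in auto)
  note c = rsubmodule_carrier[OF S]
  have fgS: "f (g s) \<in> S" if "s \<in> S" for s
    using that shift_span_fg[OF L] by (auto simp: S_def simp del: shift_span.simps)
  have indep: "s = \<zero>\<^bsub>M\<^esub> \<and> s' = \<zero>\<^bsub>M\<^esub>" if st: "s \<in> S" "s' \<in> S" "s \<oplus>\<^bsub>M\<^esub> f s' \<in> W" for s s'
  proof -
    obtain m n where "s \<in> shift_span L m" "s' \<in> shift_span L n" using st(1,2) unfolding S_def by blast
    then have "s \<in> shift_span L (max m n)" "s' \<in> shift_span L (max m n)"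
      using mono[of m "max m n"] mono[of n "max m n"] by auto
    then show ?thesis using shift_span_independent[OF W L inj disj _ _ st(3)] by blast
  qed
  define A1 where "A1 = f ` S"
  define B1 where "B1 = (\<lambda>s. s \<oplus>\<^bsub>M\<^esub> f s) ` S"
  have A1: "rsubmodule R M A1" unfolding A1_def by (rule rsubmodule_image[OF f S])
  have B1: "rsubmodule R M B1" unfolding B1_def
  proof (rule rsubmoduleI)
    show "\<zero>\<^bsub>M\<^esub> \<in> (\<lambda>s. s \<oplus>\<^bsub>M\<^esub> f s) ` S"
      using rsubmodule_zero[OF S] by (force simp: hom_simps intro!: image_eqI[of _ _ "\<zero>\<^bsub>M\<^esub>"])
    fix x y assume "x \<in> (\<lambda>s. s \<oplus>\<^bsub>M\<^esub> f s) ` S" "y \<in> (\<lambda>s. s \<oplus>\<^bsub>M\<^esub> f s) ` S"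
    then obtain s t where st: "s \<in> S" "t \<in> S" "x = s \<oplus>\<^bsub>M\<^esub> f s" "y = t \<oplus>\<^bsub>M\<^esub> f t" by blast
    then have "x \<oplus>\<^bsub>M\<^esub> y = (s \<oplus>\<^bsub>M\<^esub> t) \<oplus>\<^bsub>M\<^esub> f (s \<oplus>\<^bsub>M\<^esub> t)"
      using c by (simp add: hom_simps M.a_ac)
    then show "x \<oplus>\<^bsub>M\<^esub> y \<in> (\<lambda>s. s \<oplus>\<^bsub>M\<^esub> f s) ` S" using st rsubmodule_add[OF S] by blast
  next
    fix x r assume "x \<in> (\<lambda>s. s \<oplus>\<^bsub>M\<^esub> f s) ` S" and r: "r \<in> carrier R"
    then obtain s where st: "s \<in> S" "x = s \<oplus>\<^bsub>M\<^esub> f s" by blast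
    then have "x \<star>\<^bsub>M\<^esub> r = s \<star>\<^bsub>M\<^esub> r \<oplus>\<^bsub>M\<^esub> f (s \<star>\<^bsub>M\<^esub> r)"
      using c r by (simp add: endo_ract[OF f] ract_add_left)
    then show "x \<star>\<^bsub>M\<^esub> r \<in> (\<lambda>s. s \<oplus>\<^bsub>M\<^esub> f s) ` S" using st r rsubmodule_ract[OF S] by blast
  qed (use c in auto)
  \<comment> \<open>These two identities express relations in \<open>A1 + B1\<close> and in \<open>f A1 + g B1\<close> as relations
    in \<open>S + f S\<close>; the second uses \<open>f f = f - f g\<close> and \<open>g (1 + f) = 1 - f + f g\<close>.\<close>
  have eq1: "f s \<oplus>\<^bsub>M\<^esub> (s' \<oplus>\<^bsub>M\<^esub> f s') = s' \<oplus>\<^bsub>M\<^esub> f (s \<oplus>\<^bsub>M\<^esub> s')" if "s \<in> S" "s' \<in> S" for s s'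
    using that c by (simp add: hom_simps M.a_ac)
  have eq2: "f (f s) \<oplus>\<^bsub>M\<^esub> g (s' \<oplus>\<^bsub>M\<^esub> f s')
      = (s' \<oplus>\<^bsub>M\<^esub> (f (g s') \<oplus>\<^bsub>M\<^esub> \<ominus>\<^bsub>M\<^esub> f (g s))) \<oplus>\<^bsub>M\<^esub> f (s \<oplus>\<^bsub>M\<^esub> \<ominus>\<^bsub>M\<^esub> s')" if "s \<in> S" "s' \<in> S" for s s'
  proof -
    note cc = c[OF that(1)] c[OF that(2)]
    have "s' = f s' \<oplus>\<^bsub>M\<^esub> g s'" using f_plus_g cc by simp
    then have 1: "g s' = s' \<oplus>\<^bsub>M\<^esub> \<ominus>\<^bsub>M\<^esub> f s'"
      using cc by (metis M.a_comm M.add.inv_solve_right f_closed g_closed)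
    have "f s = f (f s) \<oplus>\<^bsub>M\<^esub> f (g s)" using f_plus_g[OF cc(1)] cc hom_simps(1) by (metis f_closed g_closed)
    then have 2: "f (f s) = f s \<oplus>\<^bsub>M\<^esub> \<ominus>\<^bsub>M\<^esub> f (g s)"
      using cc by (metis M.add.inv_solve_right f_closed g_closed)
    have "f (f s) \<oplus>\<^bsub>M\<^esub> g (s' \<oplus>\<^bsub>M\<^esub> f s') = f (f s) \<oplus>\<^bsub>M\<^esub> (g s' \<oplus>\<^bsub>M\<^esub> f (g s'))"
      using cc by (simp add: hom_simps f_g_commute)
    also have "\<dots> = (f s \<oplus>\<^bsub>M\<^esub> \<ominus>\<^bsub>M\<^esub> f (g s)) \<oplus>\<^bsub>M\<^esub> ((s' \<oplus>\<^bsub>M\<^esub> \<ominus>\<^bsub>M\<^esub> f s') \<oplus>\<^bsub>M\<^esub> f (g s'))"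
      by (simp only: 1[symmetric] 2[symmetric])
    also have "\<dots> = (s' \<oplus>\<^bsub>M\<^esub> (f (g s') \<oplus>\<^bsub>M\<^esub> \<ominus>\<^bsub>M\<^esub> f (g s))) \<oplus>\<^bsub>M\<^esub> f (s \<oplus>\<^bsub>M\<^esub> \<ominus>\<^bsub>M\<^esub> s')"
      using cc by (simp add: hom_simps M.a_ac)
    finally show ?thesis .
  qed
  let ?D = "f ` A1 <+>\<^bsub>M\<^esub> g ` B1" and ?E = "A1 <+>\<^bsub>M\<^esub> B1"
  have D: "rsubmodule R M ?D" and E: "rsubmodule R M ?E"
    using A1 B1 by (auto intro: rsubmodule_sum rsubmodule_image f g)
  have D_I: "f (f s) \<oplus>\<^bsub>M\<^esub> g (s' \<oplus>\<^bsub>M\<^esub> f s') \<in> ?D" if "s \<in> S" "s' \<in> S" for s s'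
    using that by (auto simp: set_add_def' A1_def B1_def)
  have E_I: "f s \<in> ?E" if s: "s \<in> S" for s
    using s sum_subset_left[OF A1 B1] by (auto simp: A1_def)
  have E_S: "s \<in> ?E" if s: "s \<in> S" for s
  proof -
    have "f s \<oplus>\<^bsub>M\<^esub> s \<in> ?E"
      using s sum_subset_right[OF A1 B1] c by (auto simp: B1_def M.a_comm)
    then show ?thesis using rsubmodule_add_cancel[OF E E_I[OF s]] c s by blast
  qed
  have D_S: "s \<in> ?D" if s: "s \<in> S" for s
    using D_I[OF s s] eq2[OF s s] c[OF s] by (simp add: M.r_neg hom_simps)
  have D_f: "f s \<in> ?D" if s: "s \<in> S" for s
  proof -
    have "f (f s) \<in> ?D"
      using D_I[OF s rsubmodule_zero[OF S]] c[OF s] by (simp add: hom_simps)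
    moreover have "f (f s) \<oplus>\<^bsub>M\<^esub> f (g s) = f s"
      using f_plus_g[OF c[OF s]] c[OF s] by (metis f_closed g_closed hom_simps(1))
    ultimately show ?thesis using rsubmodule_add[OF D _ D_S[OF fgS[OF s]]] by metis
  qed
  have E_ff: "f (f s) \<in> ?E" if s: "s \<in> S" for s
  proof -
    have "f (g s) \<oplus>\<^bsub>M\<^esub> f (f s) = f s"
      using f_plus_g[OF c[OF s]] c[OF s] by (metis M.a_comm f_closed g_closed hom_simps(1))
    then show ?thesis
      using rsubmodule_add_cancel[OF E E_S[OF fgS[OF s]], of "f (f s)"] E_I[OF s] c[OF s] by simp
  qed
  have E_g: "g (s \<oplus>\<^bsub>M\<^esub> f s) \<in> ?E" if s: "s \<in> S" for s
  proof -
    have "f (s \<oplus>\<^bsub>M\<^esub> f s) \<in> ?E"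
      using rsubmodule_add[OF E E_I[OF s] E_ff[OF s]] c[OF s] by (simp add: hom_simps)
    moreover have "s \<oplus>\<^bsub>M\<^esub> f s \<in> ?E" by (rule rsubmodule_add[OF E E_S[OF s] E_I[OF s]])
    ultimately show ?thesis
      using rsubmodule_add_cancel[OF E, of "f (s \<oplus>\<^bsub>M\<^esub> f s)" "g (s \<oplus>\<^bsub>M\<^esub> f s)"] c[OF s] by (simp add: f_plus_g)
  qed
  have DW: "?D \<subseteq> closure (W <+>\<^bsub>M\<^esub> ?D)" and EW: "?E \<subseteq> closure (W <+>\<^bsub>M\<^esub> ?E)"
    using sum_subset_right[OF W D] sum_subset_right[OF W E]
      subset_closure[OF rsubmodule_sum[OF W D]] subset_closure[OF rsubmodule_sum[OF W E]] by auto
  have ind: "a = \<zero>\<^bsub>M\<^esub> \<and> b = \<zero>\<^bsub>M\<^esub>" if mem: "a \<in> A1" "b \<in> B1" and w: "a \<oplus>\<^bsub>M\<^esub> b \<in> W" for a b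
  proof -
    obtain s s' where ab: "s \<in> S" "s' \<in> S" "a = f s" "b = s' \<oplus>\<^bsub>M\<^esub> f s'"
      using mem unfolding A1_def B1_def by blast
    have "s' = \<zero>\<^bsub>M\<^esub> \<and> s \<oplus>\<^bsub>M\<^esub> s' = \<zero>\<^bsub>M\<^esub>"
      using w ab eq1[OF ab(1,2)] by (intro indep) (auto intro: rsubmodule_add[OF S])
    then show ?thesis using ab c[OF ab(1)] c[OF ab(2)] by (auto simp: hom_simps)
  qed
  have "clean_pair (A <+>\<^bsub>M\<^esub> A1) (B <+>\<^bsub>M\<^esub> B1)"
  proof (rule clean_pair_sum[OF P W_def A1 B1 ind])
    fix a b assume "a \<in> A1" "b \<in> B1"
    then obtain s s' where ab: "s \<in> S" "s' \<in> S" "a = f s" "b = s' \<oplus>\<^bsub>M\<^esub> f s'"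
      by (auto simp: A1_def B1_def)
    note cc = c[OF ab(1)] c[OF ab(2)]
    show "a = \<zero>\<^bsub>M\<^esub> \<and> b = \<zero>\<^bsub>M\<^esub>" if w: "f a \<oplus>\<^bsub>M\<^esub> g b \<in> W"
    proof -
      have z: "s' \<oplus>\<^bsub>M\<^esub> (f (g s') \<oplus>\<^bsub>M\<^esub> \<ominus>\<^bsub>M\<^esub> f (g s)) = \<zero>\<^bsub>M\<^esub> \<and> s \<oplus>\<^bsub>M\<^esub> \<ominus>\<^bsub>M\<^esub> s' = \<zero>\<^bsub>M\<^esub>"
        using w ab by (intro indep) (auto simp: eq2 intro!: rsubmodule_add[OF S] rsubmodule_minus[OF S] fgS)
      then have "s = s'" using cc by (simp add: M.add.inv_solve_right')
      then show ?thesis using z ab cc by (simp add: M.r_neg hom_simps)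
    qed
  next
    have "A1 \<subseteq> ?D" "B1 \<subseteq> ?D"
      using D_S D_f rsubmodule_add[OF D] by (auto simp: A1_def B1_def)
    then show "A1 \<subseteq> closure (W <+>\<^bsub>M\<^esub> ?D)" "B1 \<subseteq> closure (W <+>\<^bsub>M\<^esub> ?D)" using DW by auto
    have "f ` A1 \<subseteq> ?E" "g ` B1 \<subseteq> ?E"
      using E_ff E_g by (auto simp: A1_def B1_def)
    then show "f ` A1 \<subseteq> closure (W <+>\<^bsub>M\<^esub> ?E)" "g ` B1 \<subseteq> closure (W <+>\<^bsub>M\<^esub> ?E)" using EW by auto
  qed
  moreover have "A1 \<noteq> {\<zero>\<^bsub>M\<^esub>}"
  proof
    let ?y = "y \<star>\<^bsub>M\<^esub> r"
    assume "A1 = {\<zero>\<^bsub>M\<^esub>}"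
    have yS: "?y \<in> S"
      using L0 sum_subset_left[OF L rsubmodule_fg[OF Sn[of 0]]]
      unfolding S_def by (intro UN_I[of "Suc 0"]) auto
    then have "f ?y = \<zero>\<^bsub>M\<^esub>" using \<open>A1 = {\<zero>\<^bsub>M\<^esub>}\<close> unfolding A1_def by blast
    then show False using indep[OF rsubmodule_zero[OF S] yS] rsubmodule_zero[OF W] r by simp
  qed
  ultimately show ?thesis
    using clean_pair_properly_extends[OF P W_def A1 B1 ind] by blast
qed

text \<open>
  If \<open>f\<close> is injective modulo \<open>W\<close> with essential image, a complement of \<open>W\<close> may be added to \<open>A\<close>
  as a whole. It exists since \<open>W\<close> has no proper essential extension, so (C1) makes \<open>W\<close> a direct
  summand.
\<close>

lemma clean_pair_extend_complement:
  assumes P: "clean_pair A B" and W_def: "W = closure (A <+>\<^bsub>M\<^esub> B)"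
    and inj: "\<And>x. \<lbrakk>x \<in> carrier M; f x \<in> W\<rbrakk> \<Longrightarrow> x \<in> W"
    and dense: "closure (f ` carrier M <+>\<^bsub>M\<^esub> W) = carrier M"
    and WM: "W \<noteq> carrier M" and C1: "cond_C1 R M"
  shows "\<exists>A' B'. clean_pair A' B' \<and> A \<subseteq> A' \<and> B \<subseteq> B' \<and> (A', B') \<noteq> (A, B)"
proof -
  note s = clean_pair_submodules[OF P, folded W_def]
    and inv = clean_pair_closure_invariant[OF P, folded W_def]
  have W: "rsubmodule R M W" using s by simp
  have Wcl: "closure W = W" using closure_idem[OF s(3)] W_def by simp
  obtain D where D: "direct_summand R M D" "essential_in R M W D"
    using C1 W by (auto simp: cond_C1_def)
  then have "D = W" using essential_in_closure[OF D(2)] Wcl by (auto simp: essential_in_def)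
  then obtain C where C: "rsubmodule R M C" "W \<inter> C = {\<zero>\<^bsub>M\<^esub>}" "W <+>\<^bsub>M\<^esub> C = carrier M"
    using D by (auto simp: direct_summand_def)
  note Z = rsubmodule_trivial
  note c = rsubmodule_carrier[OF C(1)]
  have ind: "a = \<zero>\<^bsub>M\<^esub> \<and> b = \<zero>\<^bsub>M\<^esub>" if "a \<in> C" "b \<in> {\<zero>\<^bsub>M\<^esub>}" "a \<oplus>\<^bsub>M\<^esub> b \<in> W" for a b
    using that C c by auto
  have sD: "rsubmodule R M (f ` C <+>\<^bsub>M\<^esub> g ` {\<zero>\<^bsub>M\<^esub>})" (is "rsubmodule R M ?D")
    and sE: "rsubmodule R M (C <+>\<^bsub>M\<^esub> {\<zero>\<^bsub>M\<^esub>})" (is "rsubmodule R M ?E")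
    by (intro rsubmodule_sum rsubmodule_image f g C Z)+
  note sWD = rsubmodule_sum[OF W sD] and sWE = rsubmodule_sum[OF W sE]
  have "W <+>\<^bsub>M\<^esub> C \<subseteq> W <+>\<^bsub>M\<^esub> ?E" by (rule set_add_mono[OF order_refl sum_subset_left[OF C(1) Z]])
  then have E: "carrier M \<subseteq> closure (W <+>\<^bsub>M\<^esub> ?E)" using C(3) subset_closure[OF sWE] by auto
  have Wsub: "W \<subseteq> W <+>\<^bsub>M\<^esub> ?D" and Csub: "f ` C \<subseteq> W <+>\<^bsub>M\<^esub> ?D"
    using sum_subset_left[OF W sD] sum_subset_right[OF W sD]
      sum_subset_left[OF rsubmodule_image[OF f C(1)] rsubmodule_image[OF g Z]] by auto
  have "f ` carrier M \<subseteq> f ` W <+>\<^bsub>M\<^esub> f ` C" using image_sum[OF f W C(1)] C(3) by simp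
  also have "\<dots> \<subseteq> W <+>\<^bsub>M\<^esub> ?D"
    by (rule sum_least[OF sWD]) (use inv Wsub Csub in auto)
  finally have "f ` carrier M <+>\<^bsub>M\<^esub> W \<subseteq> W <+>\<^bsub>M\<^esub> ?D"
    using sum_least[OF sWD] Wsub by blast
  from closure_mono[OF this] have D: "carrier M \<subseteq> closure (W <+>\<^bsub>M\<^esub> ?D)" by (simp only: dense)
  have "clean_pair (A <+>\<^bsub>M\<^esub> C) (B <+>\<^bsub>M\<^esub> {\<zero>\<^bsub>M\<^esub>})"
  proof (rule clean_pair_sum[OF P W_def C(1) Z ind])
    show "a = \<zero>\<^bsub>M\<^esub> \<and> b = \<zero>\<^bsub>M\<^esub>" if "a \<in> C" "b \<in> {\<zero>\<^bsub>M\<^esub>}" "f a \<oplus>\<^bsub>M\<^esub> g b \<in> W" for a b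
      using that C(2) c inj[of a] by (auto simp: hom_simps)
    show "C \<subseteq> closure (W <+>\<^bsub>M\<^esub> ?D)" "{\<zero>\<^bsub>M\<^esub>} \<subseteq> closure (W <+>\<^bsub>M\<^esub> ?D)" using D c by auto
    show "f ` C \<subseteq> closure (W <+>\<^bsub>M\<^esub> ?E)" "g ` {\<zero>\<^bsub>M\<^esub>} \<subseteq> closure (W <+>\<^bsub>M\<^esub> ?E)" using E c by auto
  qed
  moreover have "C \<noteq> {\<zero>\<^bsub>M\<^esub>}"
    using C(3) WM rsubmodule_carrier[OF W] by (auto simp: set_add_def')
  ultimately show ?thesis
    using clean_pair_properly_extends[OF P W_def C(1) Z ind] by blast
qed

section \<open>Maximal clean pairs\<close>

lemma clean_pair_Union_chain:
  assumes ne: "\<C> \<noteq> {}" and cp: "\<And>A B. (A, B) \<in> \<C> \<Longrightarrow> clean_pair A B"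
    and ch: "\<And>A B A' B'. \<lbrakk>(A, B) \<in> \<C>; (A', B') \<in> \<C>\<rbrakk> \<Longrightarrow> A \<subseteq> A' \<and> B \<subseteq> B' \<or> A' \<subseteq> A \<and> B' \<subseteq> B"
  shows "clean_pair (\<Union>(fst ` \<C>)) (\<Union>(snd ` \<C>))"
proof -
  let ?A = "\<Union>(fst ` \<C>)" and ?B = "\<Union>(snd ` \<C>)"
  have common: "\<exists>A B. (A, B) \<in> \<C> \<and> a \<in> A \<and> b \<in> B" if ab: "a \<in> ?A" "b \<in> ?B" for a b
  proof -
    obtain A B A' B' where "(A, B) \<in> \<C>" "a \<in> A" "(A', B') \<in> \<C>" "b \<in> B'" using ab by force
    then show ?thesis using ch[of A B A' B'] by blast
  qed
  have A: "rsubmodule R M ?A"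
  proof (rule rsubmodule_Union_chain)
    show "fst ` \<C> \<noteq> {}" using ne by simp
    show "rsubmodule R M N" if "N \<in> fst ` \<C>" for N using that cp clean_pair_submodules(1) by force
    show "N \<subseteq> K \<or> K \<subseteq> N" if NK: "N \<in> fst ` \<C>" "K \<in> fst ` \<C>" for N K
    proof -
      obtain B B' where "(N, B) \<in> \<C>" "(K, B') \<in> \<C>" using NK by force
      then show ?thesis using ch by blast
    qed
  qed
  have B: "rsubmodule R M ?B"
  proof (rule rsubmodule_Union_chain)
    show "snd ` \<C> \<noteq> {}" using ne by simp
    show "rsubmodule R M N" if "N \<in> snd ` \<C>" for N using that cp clean_pair_submodules(2) by force
    show "N \<subseteq> K \<or> K \<subseteq> N" if NK: "N \<in> snd ` \<C>" "K \<in> snd ` \<C>" for N K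
    proof -
      obtain B B' where "(B, N) \<in> \<C>" "(B', K) \<in> \<C>" using NK by force
      then show ?thesis using ch by blast
    qed
  qed
  have sD: "rsubmodule R M (f ` ?A <+>\<^bsub>M\<^esub> g ` ?B)" and sE: "rsubmodule R M (?A <+>\<^bsub>M\<^esub> ?B)"
    by (intro rsubmodule_sum rsubmodule_image f g A B)+
  have "?A <+>\<^bsub>M\<^esub> ?B \<subseteq> closure (f ` ?A <+>\<^bsub>M\<^esub> g ` ?B)"
  proof
    fix x assume "x \<in> ?A <+>\<^bsub>M\<^esub> ?B"
    then obtain a b where x: "a \<in> ?A" "b \<in> ?B" "x = a \<oplus>\<^bsub>M\<^esub> b" by (auto simp: set_add_def')
    then obtain A B where AB: "(A, B) \<in> \<C>" "a \<in> A" "b \<in> B" using common by blast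
    then have P: "clean_pair A B" and sub: "A \<subseteq> ?A" "B \<subseteq> ?B" using cp by force+
    have "x \<in> A <+>\<^bsub>M\<^esub> B" using AB x by (auto simp: set_add_def')
    then have "x \<in> closure (f ` A <+>\<^bsub>M\<^esub> g ` B)"
      using P subset_closure[OF clean_pair_submodules(3)[OF P]] by (auto simp: clean_pair_def)
    then show "x \<in> closure (f ` ?A <+>\<^bsub>M\<^esub> g ` ?B)"
      using closure_mono[OF set_add_mono[OF image_mono[OF sub(1)] image_mono[OF sub(2)]]] by blast
  qed
  moreover have "f ` ?A <+>\<^bsub>M\<^esub> g ` ?B \<subseteq> closure (?A <+>\<^bsub>M\<^esub> ?B)"
  proof
    fix x assume "x \<in> f ` ?A <+>\<^bsub>M\<^esub> g ` ?B"
    then obtain a b where x: "a \<in> ?A" "b \<in> ?B" "x = f a \<oplus>\<^bsub>M\<^esub> g b" unfolding set_add_def' by blast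
    then obtain A B where AB: "(A, B) \<in> \<C>" "a \<in> A" "b \<in> B" using common by blast
    then have P: "clean_pair A B" and sub: "A \<subseteq> ?A" "B \<subseteq> ?B" using cp by force+
    have "x \<in> f ` A <+>\<^bsub>M\<^esub> g ` B" using AB x by (auto simp: set_add_def')
    then have "x \<in> closure (A <+>\<^bsub>M\<^esub> B)"
      using P subset_closure[OF clean_pair_submodules(4)[OF P]] by (auto simp: clean_pair_def)
    then show "x \<in> closure (?A <+>\<^bsub>M\<^esub> ?B)"
      using closure_mono[OF set_add_mono[OF sub]] by blast
  qed
  ultimately have "closure (?A <+>\<^bsub>M\<^esub> ?B) = closure (f ` ?A <+>\<^bsub>M\<^esub> g ` ?B)"
    using closure_least[OF sD] closure_least[OF sE] by blast
  moreover have "a = \<zero>\<^bsub>M\<^esub> \<and> b = \<zero>\<^bsub>M\<^esub>"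
    if ab: "a \<in> ?A" "b \<in> ?B" "a \<oplus>\<^bsub>M\<^esub> b = \<zero>\<^bsub>M\<^esub> \<or> f a \<oplus>\<^bsub>M\<^esub> g b = \<zero>\<^bsub>M\<^esub>" for a b
  proof -
    obtain A B where AB: "(A, B) \<in> \<C>" "a \<in> A" "b \<in> B" using common ab by blast
    from cp[OF AB(1)] AB ab(3) show ?thesis unfolding clean_pair_def by blast
  qed
  ultimately show ?thesis using A B unfolding clean_pair_def by blast
qed

lemma clean_pair_trivial: "clean_pair {\<zero>\<^bsub>M\<^esub>} {\<zero>\<^bsub>M\<^esub>}"
  by (auto simp: clean_pair_def rsubmodule_trivial hom_simps)

text \<open>
  For a maximal pair none of the three enlargements is possible, and they cover every case
  in which the closure of \<open>A + B\<close> is not all of \<open>M\<close>.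
\<close>

lemma dense_clean_pair_exists:
  assumes C1: "cond_C1 R M"
  obtains A B where "clean_pair A B" "closure (A <+>\<^bsub>M\<^esub> B) = carrier M"
proof -
  let ?P = "{(A, B). clean_pair A B}"
  let ?le = "\<lambda>p q. fst p \<subseteq> fst q \<and> snd p \<subseteq> snd q"
  have "\<exists>m\<in>?P. \<forall>p\<in>?P. ?le m p \<longrightarrow> p = m"
  proof (rule predicate_Zorn)
    show "partial_order_on ?P (relation_of ?le ?P)"
      by (rule partial_order_on_relation_ofI) auto
    fix \<C> assume C: "\<C> \<in> Chains (relation_of ?le ?P)"
    show "\<exists>u\<in>?P. \<forall>p\<in>\<C>. ?le p u"
    proof (cases "\<C> = {}")
      case True
      then show ?thesis using clean_pair_trivial by blast
    next
      case False
      have *: "clean_pair (fst p) (snd p) \<and> (?le p q \<or> ?le q p)" if "p \<in> \<C>" "q \<in> \<C>" for p q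
      proof -
        have "(p, q) \<in> relation_of ?le ?P \<or> (q, p) \<in> relation_of ?le ?P"
          using C that unfolding Chains_def by blast
        then show ?thesis by (auto simp: relation_of_def case_prod_beta)
      qed
      have "clean_pair (\<Union>(fst ` \<C>)) (\<Union>(snd ` \<C>))"
      proof (rule clean_pair_Union_chain[OF False])
        show "clean_pair A B" if "(A, B) \<in> \<C>" for A B using *[OF that that] by simp
        show "A \<subseteq> A' \<and> B \<subseteq> B' \<or> A' \<subseteq> A \<and> B' \<subseteq> B" if "(A, B) \<in> \<C>" "(A', B') \<in> \<C>" for A B A' B'
          using *[OF that] by simp
      qed
      then show ?thesis by (intro bexI[of _ "(\<Union>(fst ` \<C>), \<Union>(snd ` \<C>))"]) auto
    qed
  qed
  then obtain A B where P: "clean_pair A B"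
    and max: "\<And>A' B'. \<lbrakk>clean_pair A' B'; A \<subseteq> A'; B \<subseteq> B'\<rbrakk> \<Longrightarrow> (A', B') = (A, B)"
    by fastforce
  define W where "W = closure (A <+>\<^bsub>M\<^esub> B)"
  have no: "\<not> (\<exists>A' B'. clean_pair A' B' \<and> A \<subseteq> A' \<and> B \<subseteq> B' \<and> (A', B') \<noteq> (A, B))"
    using max by blast
  have inj: "x \<in> W" if "x \<in> carrier M" "f x \<in> W" for x
    using clean_pair_extend_kernel[OF P W_def] that no by blast
  have "closure (f ` carrier M <+>\<^bsub>M\<^esub> W) = carrier M"
    using clean_pair_extend_shift[OF P W_def inj] no by blast
  then have "W = carrier M"
    using clean_pair_extend_complement[OF P W_def inj _ _ C1] no by blast
  then show thesis using that P W_def by blast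
qed

text \<open>
  Replacing \<open>A\<close> and \<open>B\<close> by summands in which they are essential keeps the independence
  conditions. By (C3) the sum of these summands is again a summand; its closure is \<open>M\<close>, so its
  complement is zero.
\<close>

lemma spanning_clean_pair_exists:
  assumes "quasi_continuous R M"
  obtains A B where "clean_pair A B" "A <+>\<^bsub>M\<^esub> B = carrier M"
proof -
  have C1: "cond_C1 R M" and C3: "cond_C3 R M" using assms by (auto simp: quasi_continuous_def)
  obtain A B where P: "clean_pair A B" and dense: "closure (A <+>\<^bsub>M\<^esub> B) = carrier M"
    using dense_clean_pair_exists[OF C1] .
  note s = clean_pair_submodules[OF P]
  obtain A' where A': "direct_summand R M A'" "essential_in R M A A'"
    using C1 s by (auto simp: cond_C1_def)
  obtain B' where B': "direct_summand R M B'" "essential_in R M B B'"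
    using C1 s by (auto simp: cond_C1_def)
  have sA: "rsubmodule R M A'" "A \<subseteq> A'" and sB: "rsubmodule R M B'" "B \<subseteq> B'"
    using A' B' by (auto simp: essential_in_def)
  have clA: "A' \<subseteq> closure A" and clB: "B' \<subseteq> closure B"
    using A' B' essential_in_closure by auto
  \<comment> \<open>The identity, to which the independence lemma is applied for relations \<open>a + b = 0\<close>.\<close>
  define i where "i = (\<lambda>x\<in>carrier M. x)"
  have i: "i \<in> rmodule_endos R M" by (auto simp: i_def rmodule_endos_def)
  have i_eq: "i x = x" if "x \<in> carrier M" for x using that by (simp add: i_def)
  have ind: "a = \<zero>\<^bsub>M\<^esub> \<and> b = \<zero>\<^bsub>M\<^esub>" if "a \<in> A'" "b \<in> B'" "a \<oplus>\<^bsub>M\<^esub> b = \<zero>\<^bsub>M\<^esub>" for a b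
    using independent_closure[OF s(1,2) i i, of a b] P that clA clB
      rsubmodule_carrier[OF s(1)] rsubmodule_carrier[OF s(2)]
      rsubmodule_carrier[OF sA(1)] rsubmodule_carrier[OF sB(1)]
    by (auto simp: clean_pair_def i_eq)
  have ind': "a = \<zero>\<^bsub>M\<^esub> \<and> b = \<zero>\<^bsub>M\<^esub>" if "a \<in> A'" "b \<in> B'" "f a \<oplus>\<^bsub>M\<^esub> g b = \<zero>\<^bsub>M\<^esub>" for a b
    using independent_closure[OF s(1,2) f g, of a b] P that clA clB
    by (auto simp: clean_pair_def)
  have "A' \<inter> B' \<subseteq> {\<zero>\<^bsub>M\<^esub>}"
  proof
    fix x assume x: "x \<in> A' \<inter> B'"
    then have "x \<oplus>\<^bsub>M\<^esub> \<ominus>\<^bsub>M\<^esub> x = \<zero>\<^bsub>M\<^esub>" using rsubmodule_carrier[OF sA(1)] by (simp add: M.r_neg)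
    then show "x \<in> {\<zero>\<^bsub>M\<^esub>}" using ind[of x "\<ominus>\<^bsub>M\<^esub> x"] x rsubmodule_minus[OF sB(1)] by auto
  qed
  then have "A' \<inter> B' = {\<zero>\<^bsub>M\<^esub>}" using rsubmodule_zero sA sB by blast
  then have "direct_summand R M (A' <+>\<^bsub>M\<^esub> B')" using C3 A' B' unfolding cond_C3_def by blast
  then obtain T where T: "rsubmodule R M T" "(A' <+>\<^bsub>M\<^esub> B') \<inter> T = {\<zero>\<^bsub>M\<^esub>}"
    "(A' <+>\<^bsub>M\<^esub> B') <+>\<^bsub>M\<^esub> T = carrier M"
    by (auto simp: direct_summand_def)
  have sS: "rsubmodule R M (A' <+>\<^bsub>M\<^esub> B')" by (rule rsubmodule_sum[OF sA(1) sB(1)])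
  have clS: "closure (A' <+>\<^bsub>M\<^esub> B') = carrier M"
    using closure_mono[OF set_add_mono[OF sA(2) sB(2)]] dense closure_carrier by blast
  have "t = \<zero>\<^bsub>M\<^esub>" if t: "t \<in> T" for t
  proof -
    have c: "t \<in> carrier M" using t T rsubmodule_carrier by blast
    have disj: "x = \<zero>\<^bsub>M\<^esub> \<and> y = \<zero>\<^bsub>M\<^esub>" if x: "x \<in> A' <+>\<^bsub>M\<^esub> B'" and y: "y \<in> T" and xy: "i x \<oplus>\<^bsub>M\<^esub> i y = \<zero>\<^bsub>M\<^esub>" for x y
    proof -
      have cc: "x \<in> carrier M" "y \<in> carrier M" using x y sS T rsubmodule_carrier by blast+
      then have "x = \<ominus>\<^bsub>M\<^esub> y" using xy by (simp add: i_eq M.minus_equality)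
      then have "x \<in> T" using y rsubmodule_minus[OF T(1)] by simp
      then have "x = \<zero>\<^bsub>M\<^esub>" using x T(2) by blast
      then show ?thesis using xy cc by (simp add: i_eq)
    qed
    have "\<ominus>\<^bsub>M\<^esub> t \<in> closure (A' <+>\<^bsub>M\<^esub> B')" "t \<in> closure T"
      using c t clS subset_closure[OF T(1)] by auto
    moreover have "i (\<ominus>\<^bsub>M\<^esub> t) \<oplus>\<^bsub>M\<^esub> i t = \<zero>\<^bsub>M\<^esub>" using c by (simp add: i_eq M.l_neg)
    ultimately show ?thesis using independent_closure[OF sS T(1) i i disj] by blast
  qed
  then have "T \<subseteq> A' <+>\<^bsub>M\<^esub> B'" using rsubmodule_zero[OF sS] by blast
  then have span: "A' <+>\<^bsub>M\<^esub> B' = carrier M"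
    using T(3) sum_least[OF sS order_refl] rsubmodule_subset[OF sS] by blast
  have "closure (f ` A <+>\<^bsub>M\<^esub> g ` B) \<subseteq> closure (f ` A' <+>\<^bsub>M\<^esub> g ` B')"
    by (intro closure_mono set_add_mono image_mono sA sB)
  moreover have "closure (f ` A <+>\<^bsub>M\<^esub> g ` B) = carrier M" using P dense by (simp add: clean_pair_def)
  ultimately have "closure (A' <+>\<^bsub>M\<^esub> B') = closure (f ` A' <+>\<^bsub>M\<^esub> g ` B')"
    using clS closure_carrier by blast
  then have "clean_pair A' B'" using sA(1) sB(1) ind ind' unfolding clean_pair_def by blast
  then show thesis using that span by blast
qed

section \<open>From clean pairs to almost clean decompositions\<close>

text \<open>
  Let \<open>e\<close> be the projection to \<open>B\<close> along \<open>A\<close>. Then \<open>u = f - e\<close> sends \<open>a + b\<close> to \<open>f a - g b\<close>. It is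
  injective, hence has zero right annihilator. Its image is \<open>f A + g B\<close>, whose closure is \<open>M\<close>; an
  endomorphism that vanishes there has values killed by essential right ideals, so it is zero
  by nonsingularity, and the left annihilator of \<open>u\<close> is zero.
\<close>

lemma decomposition_of_spanning_clean_pair:
  assumes P: "clean_pair A B" and span: "A <+>\<^bsub>M\<^esub> B = carrier M"
  shows "\<exists>u e. regular_element (End_ring R M) u \<and> idempotent_element (End_ring R M) e \<and>
    f = u \<oplus>\<^bsub>End_ring R M\<^esub> e"
proof -
  note s = clean_pair_submodules[OF P]
  note c = rsubmodule_carrier[OF s(1)] rsubmodule_carrier[OF s(2)]
  have ind: "a = \<zero>\<^bsub>M\<^esub> \<and> b = \<zero>\<^bsub>M\<^esub>" if "a \<in> A" "b \<in> B" "a \<oplus>\<^bsub>M\<^esub> b = \<zero>\<^bsub>M\<^esub>" for a b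
    using P that by (auto simp: clean_pair_def)
  have ind': "a = \<zero>\<^bsub>M\<^esub> \<and> b = \<zero>\<^bsub>M\<^esub>" if "a \<in> A" "b \<in> B" "f a \<oplus>\<^bsub>M\<^esub> g b = \<zero>\<^bsub>M\<^esub>" for a b
    using P that by (auto simp: clean_pair_def)
  have uniq: "b = b'" if ab: "a \<in> A" "b \<in> B" "a' \<in> A" "b' \<in> B" "a \<oplus>\<^bsub>M\<^esub> b = a' \<oplus>\<^bsub>M\<^esub> b'" for a b a' b'
  proof -
    note cc = c(1)[OF ab(1)] c(2)[OF ab(2)] c(1)[OF ab(3)] c(2)[OF ab(4)]
    have "(a \<oplus>\<^bsub>M\<^esub> \<ominus>\<^bsub>M\<^esub> a') \<oplus>\<^bsub>M\<^esub> (b \<oplus>\<^bsub>M\<^esub> \<ominus>\<^bsub>M\<^esub> b') = (a \<oplus>\<^bsub>M\<^esub> b) \<oplus>\<^bsub>M\<^esub> \<ominus>\<^bsub>M\<^esub> (a' \<oplus>\<^bsub>M\<^esub> b')"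
      using cc by (simp add: M.minus_add M.a_ac)
    then have "(a \<oplus>\<^bsub>M\<^esub> \<ominus>\<^bsub>M\<^esub> a') \<oplus>\<^bsub>M\<^esub> (b \<oplus>\<^bsub>M\<^esub> \<ominus>\<^bsub>M\<^esub> b') = \<zero>\<^bsub>M\<^esub>"
      using ab(5) cc by (simp add: M.r_neg)
    then have "b \<oplus>\<^bsub>M\<^esub> \<ominus>\<^bsub>M\<^esub> b' = \<zero>\<^bsub>M\<^esub>"
      using ind[OF rsubmodule_add[OF s(1) ab(1) rsubmodule_minus[OF s(1) ab(3)]]
          rsubmodule_add[OF s(2) ab(2) rsubmodule_minus[OF s(2) ab(4)]]] by simp
    then show ?thesis using cc by (simp add: M.add.inv_solve_right')
  qed
  define e where "e = (\<lambda>x\<in>carrier M. THE b. b \<in> B \<and> (\<exists>a\<in>A. x = a \<oplus>\<^bsub>M\<^esub> b))"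
  have e_eq: "e (a \<oplus>\<^bsub>M\<^esub> b) = b" if "a \<in> A" "b \<in> B" for a b
    using that c unfolding e_def by (auto intro!: the_equality dest: uniq)
  have split: "\<exists>a\<in>A. \<exists>b\<in>B. x = a \<oplus>\<^bsub>M\<^esub> b" if "x \<in> carrier M" for x
    using that unfolding span[symmetric] set_add_def' by blast
  have e_closed: "e x \<in> carrier M" if "x \<in> carrier M" for x
    using split[OF that] e_eq c by auto
  have e: "e \<in> rmodule_endos R M"
    unfolding rmodule_endos_def
  proof (intro CollectI conjI ballI)
    show "e \<in> carrier M \<rightarrow>\<^sub>E carrier M" using e_closed by (auto simp: e_def)
    fix x assume x: "x \<in> carrier M"
    obtain a b where ab: "a \<in> A" "b \<in> B" "x = a \<oplus>\<^bsub>M\<^esub> b" using split[OF x] by blast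
    note cc = c(1)[OF ab(1)] c(2)[OF ab(2)]
    show "e (x \<oplus>\<^bsub>M\<^esub> y) = e x \<oplus>\<^bsub>M\<^esub> e y" if y: "y \<in> carrier M" for y
    proof -
      obtain a' b' where ab': "a' \<in> A" "b' \<in> B" "y = a' \<oplus>\<^bsub>M\<^esub> b'" using split[OF y] by blast
      have "x \<oplus>\<^bsub>M\<^esub> y = (a \<oplus>\<^bsub>M\<^esub> a') \<oplus>\<^bsub>M\<^esub> (b \<oplus>\<^bsub>M\<^esub> b')"
        using cc c(1)[OF ab'(1)] c(2)[OF ab'(2)] ab ab' by (simp add: M.a_ac)
      then show ?thesis
        using ab ab' e_eq rsubmodule_add[OF s(1)] rsubmodule_add[OF s(2)] by simp
    qed
    show "e (x \<star>\<^bsub>M\<^esub> r) = e x \<star>\<^bsub>M\<^esub> r" if r: "r \<in> carrier R" for r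
      using ab cc r e_eq rsubmodule_ract[OF s(1)] rsubmodule_ract[OF s(2)] by (simp add: ract_add_left)
  qed
  have e_idem: "e (e x) = e x" if x: "x \<in> carrier M" for x
  proof -
    obtain a b where ab: "a \<in> A" "b \<in> B" "x = a \<oplus>\<^bsub>M\<^esub> b" using split[OF x] by blast
    then show ?thesis using e_eq[OF rsubmodule_zero[OF s(1)] ab(2)] e_eq[OF ab(1,2)] c by simp
  qed
  define u where "u = (\<lambda>x\<in>carrier M. f x \<oplus>\<^bsub>M\<^esub> \<ominus>\<^bsub>M\<^esub> e x)"
  have u: "u \<in> rmodule_endos R M"
    using e_closed by (auto simp: u_def rmodule_endos_def[of R M] endo_add[OF f] endo_add[OF e] endo_ract[OF f]
        endo_ract[OF e] M.minus_add M.a_ac ract_add_left ract_minus_left)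
  have u_eq: "u (a \<oplus>\<^bsub>M\<^esub> b) = f a \<oplus>\<^bsub>M\<^esub> g (\<ominus>\<^bsub>M\<^esub> b)" if ab: "a \<in> A" "b \<in> B" for a b
  proof -
    note cc = c(1)[OF ab(1)] c(2)[OF ab(2)]
    have "\<ominus>\<^bsub>M\<^esub> b = \<ominus>\<^bsub>M\<^esub> f b \<oplus>\<^bsub>M\<^esub> \<ominus>\<^bsub>M\<^esub> g b"
      using f_plus_g[OF cc(2)] cc M.minus_add[of "f b" "g b"] by simp
    then have "u (a \<oplus>\<^bsub>M\<^esub> b) = (f a \<oplus>\<^bsub>M\<^esub> f b) \<oplus>\<^bsub>M\<^esub> (\<ominus>\<^bsub>M\<^esub> f b \<oplus>\<^bsub>M\<^esub> \<ominus>\<^bsub>M\<^esub> g b)"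
      using cc e_eq[OF ab] by (simp add: u_def hom_simps)
    also have "\<dots> = f a \<oplus>\<^bsub>M\<^esub> \<ominus>\<^bsub>M\<^esub> g b" using cc by (simp add: M.a_assoc M.r_neg2)
    finally show ?thesis using cc by (simp add: hom_simps)
  qed
  have u_inj: "x = \<zero>\<^bsub>M\<^esub>" if x: "x \<in> carrier M" and ux: "u x = \<zero>\<^bsub>M\<^esub>" for x
  proof -
    obtain a b where ab: "a \<in> A" "b \<in> B" "x = a \<oplus>\<^bsub>M\<^esub> b" using split[OF x] by blast
    then have "a = \<zero>\<^bsub>M\<^esub> \<and> \<ominus>\<^bsub>M\<^esub> b = \<zero>\<^bsub>M\<^esub>"
      using ux u_eq[OF ab(1,2)] ind'[OF ab(1) rsubmodule_minus[OF s(2) ab(2)]] by simp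
    then show ?thesis using ab c by auto
  qed
  have u_dense: "h x = \<zero>\<^bsub>M\<^esub>" if h: "h \<in> rmodule_endos R M" and hu: "\<And>x. x \<in> carrier M \<Longrightarrow> h (u x) = \<zero>\<^bsub>M\<^esub>"
    and x: "x \<in> carrier M" for h x
  proof -
    have "h y = \<zero>\<^bsub>M\<^esub>" if y: "y \<in> f ` A <+>\<^bsub>M\<^esub> g ` B" for y
    proof -
      obtain a b where ab: "a \<in> A" "b \<in> B" "y = f a \<oplus>\<^bsub>M\<^esub> g b" using y unfolding set_add_def' by blast
      then have "y = u (a \<oplus>\<^bsub>M\<^esub> \<ominus>\<^bsub>M\<^esub> b)" using u_eq[OF ab(1), of "\<ominus>\<^bsub>M\<^esub> b"] rsubmodule_minus[OF s(2)] c by simp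
      then show ?thesis using hu ab c by simp
    qed
    then have "h ` (f ` A <+>\<^bsub>M\<^esub> g ` B) \<subseteq> {\<zero>\<^bsub>M\<^esub>}" by blast
    then have "closure (h ` (f ` A <+>\<^bsub>M\<^esub> g ` B)) \<subseteq> {\<zero>\<^bsub>M\<^esub>}" using closure_mono closure_trivial by metis
    moreover have "x \<in> closure (f ` A <+>\<^bsub>M\<^esub> g ` B)"
      using P x span subset_closure[OF rsubmodule_all] by (auto simp: clean_pair_def)
    ultimately show ?thesis using image_closure[OF h] by blast
  qed
  have zero: "h = (\<lambda>x\<in>carrier M. \<zero>\<^bsub>M\<^esub>)" if "h \<in> rmodule_endos R M" "\<And>x. x \<in> carrier M \<Longrightarrow> h x = \<zero>\<^bsub>M\<^esub>" for h
    using that by (intro ext) (auto simp: rmodule_endos_def PiE_def extensional_def)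
  have zero_endo: "(\<lambda>x\<in>carrier M. \<zero>\<^bsub>M\<^esub>) \<in> rmodule_endos R M"
    by (auto simp: rmodule_endos_def)
  have "left_annihilator (End_ring R M) u = {\<zero>\<^bsub>End_ring R M\<^esub>}"
  proof -
    have "h = (\<lambda>x\<in>carrier M. \<zero>\<^bsub>M\<^esub>)" if h: "h \<in> rmodule_endos R M" and hu: "compose (carrier M) h u = (\<lambda>x\<in>carrier M. \<zero>\<^bsub>M\<^esub>)" for h
    proof (rule zero[OF h])
      have "h (u x) = \<zero>\<^bsub>M\<^esub>" if "x \<in> carrier M" for x
        using fun_cong[OF hu, of x] that by (simp add: compose_def)
      then show "h x = \<zero>\<^bsub>M\<^esub>" if "x \<in> carrier M" for x using u_dense[OF h] that by blast
    qed
    moreover have "compose (carrier M) (\<lambda>x\<in>carrier M. \<zero>\<^bsub>M\<^esub>) u = (\<lambda>x\<in>carrier M. \<zero>\<^bsub>M\<^esub>)"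
      using rmodule_endos_closed[OF u] by (auto simp: compose_def intro!: restrict_ext)
    ultimately show ?thesis using zero_endo by (auto simp: left_annihilator_def End_ring_def)
  qed
  moreover have "right_annihilator (End_ring R M) u = {\<zero>\<^bsub>End_ring R M\<^esub>}"
  proof -
    have "h = (\<lambda>x\<in>carrier M. \<zero>\<^bsub>M\<^esub>)" if h: "h \<in> rmodule_endos R M" and uh: "compose (carrier M) u h = (\<lambda>x\<in>carrier M. \<zero>\<^bsub>M\<^esub>)" for h
    proof (rule zero[OF h])
      fix x assume x: "x \<in> carrier M"
      have "u (h x) = \<zero>\<^bsub>M\<^esub>" using fun_cong[OF uh, of x] x by (simp add: compose_def)
      then show "h x = \<zero>\<^bsub>M\<^esub>" by (rule u_inj[OF rmodule_endos_closed[OF h x]])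
    qed
    moreover have "compose (carrier M) u (\<lambda>x\<in>carrier M. \<zero>\<^bsub>M\<^esub>) = (\<lambda>x\<in>carrier M. \<zero>\<^bsub>M\<^esub>)"
      using endo_zero[OF u] by (auto simp: compose_def intro!: restrict_ext)
    ultimately show ?thesis using zero_endo by (auto simp: right_annihilator_def End_ring_def)
  qed
  ultimately have "regular_element (End_ring R M) u"
    using u by (simp add: regular_element_def End_ring_def)
  moreover have "idempotent_element (End_ring R M) e"
    using e e_idem unfolding idempotent_element_def
    by (auto simp: End_ring_def compose_def rmodule_endos_def PiE_def extensional_def)
  moreover have "f = u \<oplus>\<^bsub>End_ring R M\<^esub> e"
  proof
    fix x show "f x = (u \<oplus>\<^bsub>End_ring R M\<^esub> e) x"
    proof (cases "x \<in> carrier M")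
      case True
      then show ?thesis using e_closed by (simp add: End_ring_def u_def M.a_assoc M.l_neg)
    next
      case False
      then show ?thesis using f by (auto simp: End_ring_def rmodule_endos_def PiE_def extensional_def)
    qed
  qed
  ultimately show ?thesis by blast
qed

end

section \<open>Quasi-continuous nonsingular modules\<close>

theorem theorem2p6:
  fixes R :: "('r, 'a) ring_scheme" and M :: "('r, 'm, 'z) rmodule_scheme"
  assumes "ring R"
    and "right_module R M"
    and "quasi_continuous R M"
    and "nonsingular R M"
  shows "almost_clean_module R M"
  unfolding almost_clean_module_def almost_clean_ring_def
proof
  interpret right_module R M by fact
  fix f assume "f \<in> carrier (End_ring R M)"
  then have f: "f \<in> rmodule_endos R M" by (simp add: End_ring_def)
  note fc = rmodule_endos_closed[OF f]
  define g where "g = (\<lambda>x\<in>carrier M. x \<oplus>\<^bsub>M\<^esub> \<ominus>\<^bsub>M\<^esub> f x)"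
  have g: "g \<in> rmodule_endos R M"
    using fc by (auto simp: g_def rmodule_endos_def[of R M] endo_add[OF f] endo_ract[OF f]
        M.minus_add M.a_ac ract_add_left ract_minus_left)
  interpret complementary_endos R M f g
  proof unfold_locales
    show "f x \<oplus>\<^bsub>M\<^esub> g x = x" if "x \<in> carrier M" for x
    proof -
      have "f x \<oplus>\<^bsub>M\<^esub> g x = x \<oplus>\<^bsub>M\<^esub> (f x \<oplus>\<^bsub>M\<^esub> \<ominus>\<^bsub>M\<^esub> f x)"
        using that fc by (simp add: g_def M.a_ac)
      then show ?thesis using that fc by (simp add: M.r_neg)
    qed
  qed (fact assms f g)+
  obtain A B where "clean_pair A B" "A <+>\<^bsub>M\<^esub> B = carrier M"
    using spanning_clean_pair_exists assms by blast
  then show "\<exists>u e. regular_element (End_ring R M) u \<and> idempotent_element (End_ring R M) e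
      \<and> f = u \<oplus>\<^bsub>End_ring R M\<^esub> e"
    by (rule decomposition_of_spanning_clean_pair)
qed

end
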